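(* Let $\mathcal{G}=\{g_\lambda\}_{\lambda\in\Lambda}\cup\{g_0\}$ be a semi-discrete Bessel sequence on $\mathbb{R}^d$ with index set $\Lambda$ and output-generating function $g_0$, let $P:=\bigcup_{n=0}^{\infty}\Lambda^n$, and let $\tilde{S}[P]$ be the associated scattering transform. Let $D:=\sup\{|\xi| : \hat{g}_0(\xi)\neq 0\}$ and suppose $D<\infty$. Then, for each $c\in\mathbb{R}^d$ and each $f\in L^2(\mathbb{R}^d)$, $$\left\|\tilde{S}[P]f-\tilde{S}[P]T_cf\right\|_{L^2l^2}\leq 2\pi D|c|\,\|f\|_{L^2}.$$
   Context: Functions are complex-valued on $\mathbb{R}^d$. The Fourier transform is normalized as $\hat{f}(\xi)=\int_{\mathbb{R}^d}f(x)e^{-2\pi i x\cdot\xi}\,dx$ (extended to $L^2$ by Plancherel). The supremum of the empty set is taken to be $0$. Translation: $(T_cf)(x):=f(x-c)$. A semi-discrete Bessel sequence is a sequence (countable family) $\mathcal{G}$ of functions in $L^1(\mathbb{R}^d)\cap L^2(\mathbb{R}^d)$ with $\sum_{g\in\mathcal{G}}|\hat{g}(\xi)|^2\leq 1$ for a.e. $\xi$. If $\mathcal{G}=\{g_\lambda\}_{\lambda\in\Lambda}\cup\{g_0\}$ for a set $\Lambda$ with $0\notin\Lambda$, we say $\mathcal{G}$ has index set $\Lambda$ and output-generating function $g_0$. Scattering propagator: for $p=(\lambda_1,\dots,\lambda_k)\in\Lambda^k$ and $f\in L^2(\mathbb{R}^d)$, define inductively $\tilde{U}[p]f:=f$ if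 $k=0$ (the empty path), and $\tilde{U}[p]f:=\left|\tilde{U}[\lambda_1,\dots,\lambda_{k-1}]f*g_{\lambda_k}\right|$ if $k\geq1$. Scattering transform: $\tilde{S}[P]f:=\{\tilde{U}[p]f*g_0\}_{p\in P}$. For a family $\{h_p\}_{p\in P}$ of $L^2$ functions, $\|\{h_p\}\|_{L^2l^2}^2:=\sum_{p\in P}\|h_p\|_{L^2}^2$; differences of such families are taken entrywise. *)

theory Defs
  imports "HOL-Analysis.Analysis"
begin

text \<open>Elements of \<open>L\<^sup>1\<close> and \<open>L\<^sup>2\<close> are represented by Lebesgue measurable functions; no a.e. quotient
  is taken.\<close>

definition in_L1 :: "('a::euclidean_space \<Rightarrow> complex) \<Rightarrow> bool" where
  "in_L1 f \<longleftrightarrow> integrable lebesgue f"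

definition in_L2 :: "('a::euclidean_space \<Rightarrow> complex) \<Rightarrow> bool" where
  "in_L2 f \<longleftrightarrow> f \<in> borel_measurable lebesgue \<and> integrable lebesgue (\<lambda>x. (cmod (f x))\<^sup>2)"

text \<open>Norms take values in \<open>[0,\<infinity>]\<close>, so that a divergent integral or sum has norm \<open>\<infinity>\<close> and an
  upper bound on a norm carries the convergence with it.\<close>

definition ennreal_sqrt :: "ennreal \<Rightarrow> ennreal" where
  "ennreal_sqrt x = (if x = \<infinity> then \<infinity> else ennreal (sqrt (enn2real x)))"

lemma ennreal_sqrt_power2: "(ennreal_sqrt x)\<^sup>2 = x"
  by (cases x) (auto simp: ennreal_sqrt_def power2_eq_square ennreal_top_mult simp flip: ennreal_mult)

definition L2_norm :: "('a::euclidean_space \<Rightarrow> complex) \<Rightarrow> ennreal" where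
  "L2_norm f = ennreal_sqrt (\<integral>\<^sup>+ x. ennreal ((cmod (f x))\<^sup>2) \<partial>lebesgue)"

definition L2l2_norm :: "'p set \<Rightarrow> ('p \<Rightarrow> 'a::euclidean_space \<Rightarrow> complex) \<Rightarrow> ennreal" where
  "L2l2_norm P h = ennreal_sqrt (\<Sum>\<^sub>\<infinity>p\<in>P. (L2_norm (h p))\<^sup>2)"

text \<open>Only meaningful on \<open>L\<^sup>1\<close>; it is applied only to members of \<open>L\<^sup>1 \<inter> L\<^sup>2\<close>, where it agrees a.e.
  with the Plancherel extension.\<close>

definition fourier :: "('a::euclidean_space \<Rightarrow> complex) \<Rightarrow> 'a \<Rightarrow> complex" where
  "fourier f \<xi> = (\<integral> x. f x * exp (- 2 * of_real pi * \<i> * of_real (x \<bullet> \<xi>)) \<partial>lebesgue)"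

definition convolve :: "('a::euclidean_space \<Rightarrow> complex) \<Rightarrow> ('a \<Rightarrow> complex) \<Rightarrow> 'a \<Rightarrow> complex" where
  "convolve f g x = (\<integral> y. f y * g (x - y) \<partial>lebesgue)"

definition translate :: "'a::euclidean_space \<Rightarrow> ('a \<Rightarrow> complex) \<Rightarrow> 'a \<Rightarrow> complex" where
  "translate c f x = f (x - c)"

text \<open>The family is \<open>g i\<close> for \<open>i \<in> \<Lambda> \<union> {0}\<close>: the element \<open>0\<close> of the index type serves only as the
  label, outside \<open>\<Lambda>\<close>, of the output-generating function \<open>g 0\<close>.\<close>

definition semi_discrete_bessel :: "'i::zero set \<Rightarrow> ('i \<Rightarrow> 'a::euclidean_space \<Rightarrow> complex) \<Rightarrow> bool" where
  "semi_discrete_bessel \<Lambda> g \<longleftrightarrow>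
     countable \<Lambda> \<and> 0 \<notin> \<Lambda> \<and>
     (\<forall>i\<in>insert 0 \<Lambda>. in_L1 (g i) \<and> in_L2 (g i)) \<and>
     (AE \<xi> in lebesgue. (\<Sum>\<^sub>\<infinity>i\<in>insert 0 \<Lambda>. ennreal ((cmod (fourier (g i) \<xi>))\<^sup>2)) \<le> 1)"

text \<open>The first entry of the path acts first; see \<open>propagator_Nil\<close> and \<open>propagator_snoc\<close>.\<close>

definition propagator ::
    "('i \<Rightarrow> 'a::euclidean_space \<Rightarrow> complex) \<Rightarrow> 'i list \<Rightarrow> ('a \<Rightarrow> complex) \<Rightarrow> 'a \<Rightarrow> complex" where
  "propagator g p f = foldl (\<lambda>h l x. of_real (cmod (convolve h (g l) x))) f p"

lemma propagator_Nil: "propagator g [] f = f"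
  by (simp add: propagator_def)

lemma propagator_snoc:
  "propagator g (p @ [l]) f = (\<lambda>x. of_real (cmod (convolve (propagator g p f) (g l) x)))"
  by (simp add: propagator_def)

definition scattering ::
    "('i::zero \<Rightarrow> 'a::euclidean_space \<Rightarrow> complex) \<Rightarrow> ('a \<Rightarrow> complex) \<Rightarrow> 'i list \<Rightarrow> 'a \<Rightarrow> complex" where
  "scattering g f p = convolve (propagator g p f) (g 0)"

end

theory Submission
  imports Defs "HOL-Probability.Probability"
begin

text \<open>Since translation commutes with the propagator, the \<open>p\<close>-th entry of the difference is the
  propagated signal \<open>h = propagator g p f\<close> convolved with \<open>k = g 0 - translate c (g 0)\<close>, and on the
  support of \<open>fourier (g 0)\<close> one has \<open>\<bar>fourier k\<bar> = \<bar>1 - exp (- 2 \<pi> \<i> c \<bullet> \<xi>)\<bar> \<bar>fourier (g 0)\<bar> \<le> K \<bar>fourier (g 0)\<bar>\<close>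
  with \<open>K = 2 \<pi> D \<bar>c\<bar>\<close>. So \<open>k\<close> together with the \<open>K g \<lambda>\<close> is again a Bessel family, with bound \<open>K\<^sup>2\<close>:
  \<open>\<parallel>h * k\<parallel>\<^sup>2 + K\<^sup>2 (\<Sum>\<lambda>. \<parallel>h * g \<lambda>\<parallel>\<^sup>2) \<le> K\<^sup>2 \<parallel>h\<parallel>\<^sup>2\<close>. The second term is the energy handed on to the
  paths one step longer, so induction on the path length bounds the total by \<open>K\<^sup>2 \<parallel>f\<parallel>\<^sup>2\<close>.

  Only inequalities of Plancherel type are needed, and only for \<open>L\<^sup>1\<close> functions; they come from
  inserting a Gaussian factor. The convolution inequality is first obtained for continuous \<open>h\<close> and
  passes to \<open>L\<^sup>2\<close> by Fatou's lemma, because \<open>k\<close> in \<open>L\<^sup>2\<close> makes \<open>h * k\<close> converge at every point.\<close>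

subsection \<open>Reflections and translations\<close>

text \<open>The map is affine with every diagonal factor -1, so its Jacobian has absolute value 1.
  Completed and Borel versions both occur: convolutions and transforms are defined with
  \<open>lebesgue\<close>, while Fubini's theorem is applied to products of
  \<open>lborel\<close>.\<close>

lemma lebesgue_distr_reflect:
  fixes a :: "'a::euclidean_space"
  shows "(\<lambda>y. a - y) \<in> lebesgue \<rightarrow>\<^sub>M lebesgue" and "distr lebesgue lebesgue (\<lambda>y. a - y) = lebesgue"
proof -
  have eq: "(\<lambda>x. a + (\<Sum>j\<in>Basis. (- 1 * (x \<bullet> j)) *\<^sub>R j)) = (\<lambda>y. a - y)"
    by (simp add: euclidean_representation sum_negf)
  show "(\<lambda>y. a - y) \<in> lebesgue \<rightarrow>\<^sub>M lebesgue"
    using lebesgue_affine_measurable[of "\<lambda>_. -1" a] unfolding eq by simp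
  show "distr lebesgue lebesgue (\<lambda>y. a - y) = lebesgue"
    using lebesgue_affine_euclidean[of "\<lambda>_. -1" a] unfolding eq by (simp add: density_1)
qed

lemma lebesgue_distr_shift:
  fixes a :: "'a::euclidean_space"
  shows "(\<lambda>y. y - a) \<in> lebesgue \<rightarrow>\<^sub>M lebesgue" and "distr lebesgue lebesgue (\<lambda>y. y - a) = lebesgue"
proof -
  have eq: "(\<lambda>x. - a + (\<Sum>j\<in>Basis. (1 * (x \<bullet> j)) *\<^sub>R j)) = (\<lambda>y. y - a)"
    by (simp add: euclidean_representation)
  show "(\<lambda>y. y - a) \<in> lebesgue \<rightarrow>\<^sub>M lebesgue"
    using lebesgue_affine_measurable[of "\<lambda>_. 1" "- a"] unfolding eq by simp
  show "distr lebesgue lebesgue (\<lambda>y. y - a) = lebesgue"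
    using lebesgue_affine_euclidean[of "\<lambda>_. 1" "- a"] unfolding eq by (simp add: density_1)
qed

lemma lborel_distr_reflect:
  fixes a :: "'a::euclidean_space"
  shows "distr lborel borel (\<lambda>y. a - y) = lborel"
  by (subst (2) lborel_affine[of "-1" a]) (auto simp: density_1)

lemma lborel_distr_shift:
  fixes a :: "'a::euclidean_space"
  shows "distr lborel borel (\<lambda>y. y - a) = lborel"
  by (subst (2) lborel_affine[of 1 "- a"]) (auto simp: density_1)

lemma integral_lborel_reflect:
  fixes a :: "'a::euclidean_space" and f :: "'a \<Rightarrow> 'b::{banach, second_countable_topology}"
  assumes [measurable]: "f \<in> borel_measurable borel"
  shows "(\<integral>y. f (a - y) \<partial>lborel) = (\<integral>y. f y \<partial>lborel)"
  by (subst (2) lborel_distr_reflect[of a, symmetric]) (simp add: integral_distr)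

lemma nn_integral_lborel_reflect:
  fixes a :: "'a::euclidean_space"
  assumes [measurable]: "f \<in> borel_measurable borel"
  shows "(\<integral>\<^sup>+y. f (a - y) \<partial>lborel) = (\<integral>\<^sup>+y. f y \<partial>lborel)"
  by (subst (2) lborel_distr_reflect[of a, symmetric]) (simp add: nn_integral_distr)

lemma fourier_lborel:
  assumes [measurable]: "f \<in> borel_measurable borel"
  shows "fourier f \<xi> = (\<integral>x. f x * exp (- 2 * of_real pi * \<i> * of_real (x \<bullet> \<xi>)) \<partial>lborel)"
  unfolding fourier_def by (rule integral_completion) measurable

lemma convolve_lborel:
  assumes [measurable]: "f \<in> borel_measurable borel" "g \<in> borel_measurable borel"
  shows "convolve f g x = (\<integral>y. f y * g (x - y) \<partial>lborel)"
  unfolding convolve_def by (rule integral_completion) measurable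

lemma norm_fourier_kernel [simp]:
  "cmod (exp (- 2 * of_real pi * \<i> * of_real a)) = 1"
  "cmod (exp (- (2 * of_real pi * \<i> * of_real a))) = 1"
  by (simp_all add: norm_exp_eq_Re)

subsection \<open>The Gaussian and its Fourier transform\<close>

definition gauss :: "'a::euclidean_space \<Rightarrow> real" where
  "gauss x = exp (- pi * (norm x)\<^sup>2)"

lemma gauss_measurable [measurable]: "gauss \<in> borel_measurable borel"
  unfolding gauss_def by measurable

lemma gauss_nonneg [simp]: "0 \<le> gauss x" and gauss_le_1: "gauss x \<le> 1" and gauss_0 [simp]: "gauss 0 = 1"
  by (auto simp: gauss_def)

text \<open>Under the e^(-2 pi i x \<xi>) normalization the self-dual Gaussian is e^(-pi x^2). Its
  transform is read off from the characteristic function of the standard normal distribution by a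
  linear change of variable.\<close>

lemma gauss_1d:
  shows "integrable lborel (\<lambda>x::real. complex_of_real (exp (- pi * x\<^sup>2)) * exp (- 2 * of_real pi * \<i> * of_real (x * \<xi>)))"
    and "(\<integral>x. complex_of_real (exp (- pi * x\<^sup>2)) * exp (- 2 * of_real pi * \<i> * of_real (x * \<xi>)) \<partial>lborel)
      = complex_of_real (exp (- pi * \<xi>\<^sup>2))"
proof -
  \<comment> \<open>Substituting z = s x turns z^2 / 2 into pi x^2, and the Jacobian |s| cancels the
    factor 1 / sqrt (2 pi) of the normal density.\<close>
  define s where "s = sqrt (2 * pi)"
  have s: "s \<noteq> 0" "s\<^sup>2 = 2 * pi" "\<bar>s\<bar> = sqrt (2 * pi)" by (auto simp: s_def)
  let ?F = "\<lambda>z. std_normal_density z *\<^sub>R iexp (s * - \<xi> * z)"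
  have int: "integrable lborel ?F"
  proof (rule Bochner_Integration.integrable_bound)
    show "integrable lborel (std_normal_density)" by simp
  qed auto
  \<comment> \<open>At z = s x the frequency \<open>s * - \<xi>\<close> gives the phase -2 pi x
    \<xi>, because s^2 = 2 pi.\<close>
  have "char std_normal_distribution (s * - \<xi>) = (\<integral>z. ?F z \<partial>lborel)"
    unfolding char_def by (subst integral_density) auto
  then have "(\<integral>z. ?F z \<partial>lborel) = of_real (exp (- ((s * - \<xi>)^2) / 2))"
    by (simp add: char_std_normal_distribution)
  also have "- ((s * - \<xi>)^2) / 2 = - pi * \<xi>\<^sup>2"
    using s by (simp add: power_mult_distrib)
  finally have 1: "(\<integral>z. ?F z \<partial>lborel) = of_real (exp (- pi * \<xi>\<^sup>2))" .
  have F: "?F (0 + s * x) = (1 / \<bar>s\<bar>) *\<^sub>R (complex_of_real (exp (- pi * x\<^sup>2)) * exp (- 2 * of_real pi * \<i> * of_real (x * \<xi>)))" for x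
  proof -
    have "std_normal_density (s * x) = (1 / \<bar>s\<bar>) * exp (- pi * x\<^sup>2)"
      by (simp add: normal_density_def s power_mult_distrib)
    moreover have "s * - \<xi> * (s * x) = 2 * pi * (x * - \<xi>)"
      using s by (simp add: power2_eq_square algebra_simps)
    ultimately have "?F (s * x) = ((1 / \<bar>s\<bar>) * exp (- pi * x\<^sup>2)) *\<^sub>R exp (\<i> * of_real (2 * pi * (x * - \<xi>)))"
      by (simp only:)
    moreover have "iexp (2 * pi * (x * - \<xi>)) = exp (- 2 * of_real pi * \<i> * of_real (x * \<xi>))"
      by (rule arg_cong[where f = exp]) simp
    ultimately show ?thesis
      by (simp add: scaleR_conv_of_real)
  qed
  let ?H = "\<lambda>x. complex_of_real (exp (- pi * x\<^sup>2)) * exp (- 2 * of_real pi * \<i> * of_real (x * \<xi>))"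
  have eq: "\<bar>s\<bar> *\<^sub>R (1 / \<bar>s\<bar>) *\<^sub>R z = z" for z :: complex
    unfolding scaleR_scaleR using s(1) by simp
  have "integrable lborel (\<lambda>x. (1 / \<bar>s\<bar>) *\<^sub>R ?H x)"
    using lborel_integrable_real_affine[OF int s(1), of 0] unfolding F .
  then have "integrable lborel (\<lambda>x. \<bar>s\<bar> *\<^sub>R (1 / \<bar>s\<bar>) *\<^sub>R ?H x)"
    by (rule integrable_scaleR_right)
  then show "integrable lborel ?H"
    unfolding eq .
  have "(\<integral>x. ?F x \<partial>lborel) = \<bar>s\<bar> *\<^sub>R (\<integral>x. (1 / \<bar>s\<bar>) *\<^sub>R ?H x \<partial>lborel)"
    using lborel_integral_real_affine[OF s(1), of ?F 0] unfolding F .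
  then show "(\<integral>x. ?H x \<partial>lborel) = complex_of_real (exp (- pi * \<xi>\<^sup>2))"
    unfolding 1 integral_scaleR_right eq by (rule sym)
qed

lemma gauss_prod: "gauss x = (\<Prod>b\<in>Basis. exp (- pi * (x \<bullet> b)\<^sup>2))"
proof -
  have "(norm x)\<^sup>2 = (\<Sum>b\<in>Basis. (x \<bullet> b)\<^sup>2)"
    by (subst power2_norm_eq_inner, subst euclidean_inner) (simp add: power2_eq_square)
  then show ?thesis
    by (simp add: gauss_def exp_sum[symmetric] sum_distrib_left sum_negf)
qed

text \<open>\<open>lborel_eq\<close> presents Lebesgue measure on the space as the image of a
  product of one-dimensional measures under the map that assembles a vector from its coordinates, so
  the facts about product measures carry over.\<close>

lemma
  fixes f :: "'a::euclidean_space \<Rightarrow> real \<Rightarrow> 'b::{real_normed_field, banach, second_countable_topology}"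
  assumes f: "\<And>b. b \<in> Basis \<Longrightarrow> integrable lborel (f b)"
  shows integrable_lborel_prod: "integrable lborel (\<lambda>x. \<Prod>b\<in>Basis. f b (x \<bullet> b))"
    and integral_lborel_prod: "(\<integral>x. (\<Prod>b\<in>Basis. f b (x \<bullet> b)) \<partial>lborel) = (\<Prod>b\<in>Basis. \<integral>x. f b x \<partial>lborel)"
proof -
  interpret product_sigma_finite "\<lambda>_::'a. lborel :: real measure" by standard
  have [measurable]: "f b \<in> borel_measurable borel" if "b \<in> Basis" for b
    using f[OF that] by (simp add: integrable_iff_bounded)
  have T: "(\<lambda>x. \<Sum>b\<in>Basis. x b *\<^sub>R b) \<in> (\<Pi>\<^sub>M b\<in>Basis. lborel) \<rightarrow>\<^sub>M (borel :: 'a measure)"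
    by measurable
  have m: "(\<lambda>x::'a. \<Prod>b\<in>Basis. f b (x \<bullet> b)) \<in> borel_measurable borel"
    by measurable
  have eq: "(\<Prod>b\<in>Basis. f b ((\<Sum>i\<in>Basis. x i *\<^sub>R i) \<bullet> b)) = (\<Prod>b\<in>Basis. f b (x b))" for x :: "'a \<Rightarrow> real"
    by (intro prod.cong) (simp_all add: inner_sum_left inner_Basis if_distrib cong: if_cong)
  show "integrable lborel (\<lambda>x. \<Prod>b\<in>Basis. f b (x \<bullet> b))"
    unfolding lborel_eq[where 'a='a] integrable_distr_eq[OF T m] eq
    by (rule product_integrable_prod) (auto intro: f)
  show "(\<integral>x. (\<Prod>b\<in>Basis. f b (x \<bullet> b)) \<partial>lborel) = (\<Prod>b\<in>Basis. \<integral>x. f b x \<partial>lborel)"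
    unfolding lborel_eq[where 'a='a] integral_distr[OF T m] eq
    by (rule product_integral_prod) (auto intro: f)
qed

text \<open>Both the Gaussian and the Fourier kernel factor over the coordinates, which reduces
  everything to \<open>gauss_1d\<close>.\<close>

lemma
  fixes \<xi> :: "'a::euclidean_space"
  shows integrable_gauss: "integrable lborel (gauss :: 'a \<Rightarrow> real)"
    and fourier_gauss: "fourier (\<lambda>x. of_real (gauss x)) \<xi> = of_real (gauss \<xi>)"
proof -
  have eq: "complex_of_real (gauss x) * exp (- 2 * of_real pi * \<i> * of_real (x \<bullet> \<xi>))
     = (\<Prod>b\<in>Basis. complex_of_real (exp (- pi * (x \<bullet> b)\<^sup>2)) * exp (- 2 * of_real pi * \<i> * of_real (x \<bullet> b * (\<xi> \<bullet> b))))" for x \<xi> :: 'a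
  proof -
    have "- 2 * of_real pi * \<i> * of_real (x \<bullet> \<xi>) = (\<Sum>b\<in>Basis. - 2 * of_real pi * \<i> * of_real (x \<bullet> b * (\<xi> \<bullet> b)))"
      by (simp only: euclidean_inner[of x \<xi>] sum_distrib_left of_real_sum)
    then show ?thesis
      by (simp only: gauss_prod of_real_prod prod.distrib exp_sum finite_Basis)
  qed
  \<comment> \<open>At frequency 0 the Fourier kernel is 1, so this is integrability of the Gaussian
    itself.\<close>
  have "complex_integrable lborel (\<lambda>x::'a. of_real (gauss x) * exp (- 2 * of_real pi * \<i> * of_real (x \<bullet> 0)))"
    unfolding eq by (intro integrable_lborel_prod gauss_1d)
  then show "integrable lborel (gauss :: 'a \<Rightarrow> real)"
    by (simp add: complex_of_real_integrable_eq)
  show "fourier (\<lambda>x. of_real (gauss x)) \<xi> = of_real (gauss \<xi>)"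
    by (subst fourier_lborel, measurable, unfold eq, subst integral_lborel_prod, rule gauss_1d(1))
       (simp only: gauss_1d(2) gauss_prod[of \<xi>] of_real_prod)
qed

text \<open>The kernel \<open>gauss_kernel t\<close> is the Fourier transform of \<open>\<lambda>\<xi>. gauss (t *\<^sub>R \<xi>)\<close>.\<close>

definition gauss_kernel :: "real \<Rightarrow> 'a::euclidean_space \<Rightarrow> real" where
  "gauss_kernel t x = gauss (x /\<^sub>R t) / t ^ DIM('a)"

lemma gauss_kernel_measurable [measurable]: "gauss_kernel t \<in> borel_measurable borel"
  unfolding gauss_kernel_def by measurable

lemma gauss_kernel_nonneg: "0 < t \<Longrightarrow> 0 \<le> gauss_kernel t x"
  by (simp add: gauss_kernel_def)

lemma gauss_kernel_commute: "gauss_kernel t (x - y) = gauss_kernel t (y - x)"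
  by (simp add: gauss_kernel_def gauss_def norm_minus_commute)

lemma
  fixes f :: "'a::euclidean_space \<Rightarrow> 'b::{banach, second_countable_topology}"
  assumes t: "t > 0" and [measurable]: "f \<in> borel_measurable borel"
  shows integral_lborel_scale: "(\<integral>x. f x \<partial>lborel) = (t ^ DIM('a)) *\<^sub>R (\<integral>x. f (t *\<^sub>R x) \<partial>lborel)"
    and integrable_lborel_scale: "integrable lborel (\<lambda>x. f (t *\<^sub>R x)) \<longleftrightarrow> integrable lborel f"
proof -
  have eq: "lborel = density (distr lborel borel (\<lambda>x. t *\<^sub>R x)) (\<lambda>_::'a. ennreal (t ^ DIM('a)))"
    using lborel_affine[of t "0::'a"] t by (simp add: ennreal_power)
  show "(\<integral>x. f x \<partial>lborel) = (t ^ DIM('a)) *\<^sub>R (\<integral>x. f (t *\<^sub>R x) \<partial>lborel)"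
    using t by (subst eq) (simp add: integral_density integral_distr)
  have *: "integrable lborel (\<lambda>x. t ^ DIM('a) *\<^sub>R f (t *\<^sub>R x)) \<longleftrightarrow> integrable lborel (\<lambda>x. f (t *\<^sub>R x))"
    using t integrable_scaleR_right[of "inverse (t ^ DIM('a))" lborel "\<lambda>x. t ^ DIM('a) *\<^sub>R f (t *\<^sub>R x)"] by auto
  have "integrable lborel f \<longleftrightarrow> integrable (density (distr lborel borel (\<lambda>x. t *\<^sub>R x)) (\<lambda>_::'a. ennreal (t ^ DIM('a)))) f"
    using eq by simp
  also have "\<dots> \<longleftrightarrow> integrable lborel (\<lambda>x. f (t *\<^sub>R x))"
    using t by (subst integrable_density) (auto simp: integrable_distr_eq *)
  finally show "integrable lborel (\<lambda>x. f (t *\<^sub>R x)) \<longleftrightarrow> integrable lborel f" by simp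
qed

lemma integral_gauss: "(\<integral>x. gauss (x::'a::euclidean_space) \<partial>lborel) = 1"
proof -
  have "complex_of_real (\<integral>x. gauss (x::'a) \<partial>lborel) = fourier (\<lambda>x. of_real (gauss x)) (0::'a)"
    by (subst fourier_lborel) auto
  then show ?thesis by (simp add: fourier_gauss)
qed

lemma
  fixes t :: real
  assumes t: "t > 0"
  shows integrable_gauss_kernel: "integrable lborel (gauss_kernel t :: 'a::euclidean_space \<Rightarrow> real)"
    and integral_gauss_kernel: "(\<integral>x. gauss_kernel t (x::'a) \<partial>lborel) = 1"
proof -
  have eq: "gauss_kernel t (t *\<^sub>R x) = gauss x / t ^ DIM('a)" for x :: 'a
    using t by (simp add: gauss_kernel_def)
  show "integrable lborel (gauss_kernel t :: 'a \<Rightarrow> real)"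
    by (subst integrable_lborel_scale[OF t, symmetric]) (auto simp: eq integrable_gauss)
  show "(\<integral>x. gauss_kernel t (x::'a) \<partial>lborel) = 1"
    using t by (subst integral_lborel_scale[OF t]) (auto simp: eq integral_gauss)
qed

lemma nn_integral_gauss_kernel:
  assumes t: "t > 0"
  shows "(\<integral>\<^sup>+x. ennreal (gauss_kernel t (x::'a::euclidean_space)) \<partial>lborel) = 1"
  using t by (subst nn_integral_eq_integral) (auto simp: integrable_gauss_kernel integral_gauss_kernel gauss_kernel_nonneg)

lemma integrable_gauss_scale:
  assumes t: "t > 0"
  shows "integrable lborel (\<lambda>\<xi>::'a::euclidean_space. gauss (t *\<^sub>R \<xi>))"
  using integrable_lborel_scale[OF t, of gauss] by (simp add: integrable_gauss)

lemma fourier_gauss_scale: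
  fixes x :: "'a::euclidean_space"
  assumes t: "t > 0"
  shows "fourier (\<lambda>\<xi>. of_real (gauss (t *\<^sub>R \<xi>))) x = of_real (gauss_kernel t x)"
proof -
  let ?f = "\<lambda>\<xi>::'a. complex_of_real (gauss \<xi>) * exp (- 2 * of_real pi * \<i> * of_real (\<xi> \<bullet> (x /\<^sub>R t)))"
  have "of_real (gauss (x /\<^sub>R t)) = (\<integral>\<xi>. ?f \<xi> \<partial>lborel)"
    by (subst fourier_gauss[symmetric], subst fourier_lborel) auto
  also have "\<dots> = (t ^ DIM('a)) *\<^sub>R (\<integral>\<xi>. ?f (t *\<^sub>R \<xi>) \<partial>lborel)"
    by (rule integral_lborel_scale[OF t]) measurable
  also have "(\<integral>\<xi>. ?f (t *\<^sub>R \<xi>) \<partial>lborel) = fourier (\<lambda>\<xi>. of_real (gauss (t *\<^sub>R \<xi>))) x"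
  proof -
    have "(t *\<^sub>R \<xi>) \<bullet> (x /\<^sub>R t) = \<xi> \<bullet> x" for \<xi>
      using t by simp
    then show ?thesis
      by (subst fourier_lborel, measurable, simp only:)
  qed
  finally show ?thesis using t
    by (simp add: gauss_kernel_def scaleR_conv_of_real field_simps)
qed

subsection \<open>Plancherel inequalities\<close>

text \<open>Fatou's lemma in the form that removes a Gaussian regularization: a uniform bound on the
  integrals survives an a.e. limit, with no dominating function involved.\<close>

lemma nn_integral_tendsto_le:
  fixes u :: "nat \<Rightarrow> 'a \<Rightarrow> ennreal"
  assumes "\<And>n. u n \<in> borel_measurable M"
    and lim: "AE x in M. (\<lambda>n. u n x) \<longlonglongrightarrow> v x"
    and le: "\<And>n. (\<integral>\<^sup>+x. u n x \<partial>M) \<le> C"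
  shows "(\<integral>\<^sup>+x. v x \<partial>M) \<le> C"
proof -
  have "(\<integral>\<^sup>+x. v x \<partial>M) = (\<integral>\<^sup>+x. liminf (\<lambda>n. u n x) \<partial>M)"
    using lim by (intro nn_integral_cong_AE) (auto elim!: eventually_mono simp: lim_imp_Liminf)
  also have "\<dots> \<le> liminf (\<lambda>n. \<integral>\<^sup>+x. u n x \<partial>M)"
    by (rule nn_integral_liminf) fact
  also have "\<dots> \<le> C"
    using Liminf_mono[of "\<lambda>n. \<integral>\<^sup>+x. u n x \<partial>M" "\<lambda>_. C" sequentially] le by (simp add: Liminf_const)
  finally show ?thesis .
qed

lemma ennreal_power2_tendsto:
  fixes f :: "'b \<Rightarrow> complex"
  assumes "(f \<longlongrightarrow> l) F"
  shows "((\<lambda>x. ennreal ((cmod (f x))\<^sup>2)) \<longlongrightarrow> ennreal ((cmod l)\<^sup>2)) F"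
  by (intro tendsto_ennrealI tendsto_intros assms)

lemma borel_measurable_integrable_lborel:
  "integrable lborel f \<Longrightarrow> f \<in> borel_measurable borel"
  using borel_measurable_integrable[of lborel f] by simp

lemma integrable_lborel_pair_mult:
  fixes f :: "'a::euclidean_space \<Rightarrow> complex" and g :: "'b::euclidean_space \<Rightarrow> complex"
  assumes f: "integrable lborel f" and g: "integrable lborel g"
  shows "integrable (lborel \<Otimes>\<^sub>M lborel) (\<lambda>(x, y). f x * g y)"
proof (rule lborel_pair.Fubini_integrable)
  have [measurable]: "f \<in> borel_measurable borel" "g \<in> borel_measurable borel"
    using assms by (auto intro: borel_measurable_integrable_lborel)
  show "(\<lambda>(x, y). f x * g y) \<in> borel_measurable (lborel \<Otimes>\<^sub>M lborel)" by measurable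
  show "integrable lborel (\<lambda>x. \<integral>y. norm (case (x, y) of (x, y) \<Rightarrow> f x * g y) \<partial>lborel)"
    using f by (simp add: norm_mult)
  show "AE x in lborel. integrable lborel (\<lambda>y. case (x, y) of (x, y) \<Rightarrow> f x * g y)"
    using g by simp
qed

lemma fourier_measurable [measurable]:
  assumes [measurable]: "f \<in> borel_measurable borel"
  shows "fourier f \<in> borel_measurable borel"
  unfolding fourier_lborel[OF assms] by measurable

lemma integrable_fourier_kernel:
  assumes f: "integrable lborel f"
  shows "integrable lborel (\<lambda>x. f x * exp (- 2 * of_real pi * \<i> * of_real (x \<bullet> \<xi>)))"
proof (rule Bochner_Integration.integrable_bound[OF f])
  have [measurable]: "f \<in> borel_measurable borel"
    using assms by (auto intro: borel_measurable_integrable_lborel)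
  show "(\<lambda>x. f x * exp (- 2 * of_real pi * \<i> * of_real (x \<bullet> \<xi>))) \<in> borel_measurable lborel" by measurable
qed (simp add: norm_mult)

lemma norm_fourier_le:
  assumes f: "integrable lborel f"
  shows "cmod (fourier f \<xi>) \<le> (\<integral>x. cmod (f x) \<partial>lborel)"
proof -
  have "cmod (fourier f \<xi>) \<le> (\<integral>x. cmod (f x * exp (- 2 * of_real pi * \<i> * of_real (x \<bullet> \<xi>))) \<partial>lborel)"
    unfolding fourier_lborel[OF borel_measurable_integrable_lborel[OF f]]
    by (rule integral_norm_bound)
  then show ?thesis by (simp add: norm_mult)
qed

text \<open>The multiplication formula: the kernel has modulus 1 and is symmetric in x and \<xi>, so
  Fubini's theorem moves the transform from one factor to the other. It does the work of Fourier
  inversion in what follows.\<close>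

lemma integral_fourier_mult:
  assumes f: "integrable lborel f" and g: "integrable lborel g"
  shows "(\<integral>\<xi>. fourier f \<xi> * g \<xi> \<partial>lborel) = (\<integral>x. f x * fourier g x \<partial>lborel)"
proof -
  have [measurable]: "f \<in> borel_measurable borel" "g \<in> borel_measurable borel"
    using assms by (auto intro: borel_measurable_integrable_lborel)
  let ?k = "\<lambda>x \<xi>. f x * g \<xi> * exp (- 2 * of_real pi * \<i> * of_real (x \<bullet> \<xi>))"
  have int: "integrable (lborel \<Otimes>\<^sub>M lborel) (\<lambda>(x, \<xi>). ?k x \<xi>)"
  proof (rule Bochner_Integration.integrable_bound[OF integrable_lborel_pair_mult[OF f g]])
    show "(\<lambda>(x, \<xi>). ?k x \<xi>) \<in> borel_measurable (lborel \<Otimes>\<^sub>M lborel)" by measurable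
  qed (auto simp: norm_mult)
  have "(\<integral>\<xi>. fourier f \<xi> * g \<xi> \<partial>lborel) = (\<integral>\<xi>. (\<integral>x. ?k x \<xi> \<partial>lborel) \<partial>lborel)"
    by (subst fourier_lborel, measurable, subst integral_mult_left_zero[symmetric]) (simp add: mult_ac)
  also have "\<dots> = (\<integral>x. (\<integral>\<xi>. ?k x \<xi> \<partial>lborel) \<partial>lborel)"
    by (rule lborel_pair.Fubini_integral[OF int])
  also have "\<dots> = (\<integral>x. f x * fourier g x \<partial>lborel)"
    by (subst fourier_lborel, measurable, subst integral_mult_right_zero[symmetric]) (simp add: mult_ac inner_commute)
  finally show ?thesis .
qed

lemma integrable_bounded_mult:
  fixes f g :: "'a \<Rightarrow> complex"
  assumes g: "integrable M g" and f: "f \<in> borel_measurable M" and B: "\<And>x. cmod (f x) \<le> B"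
  shows "integrable M (\<lambda>x. f x * g x)"
proof (rule Bochner_Integration.integrable_bound)
  show "integrable M (\<lambda>x. of_real B * g x)" using g by simp
  show "(\<lambda>x. f x * g x) \<in> borel_measurable M"
    using f borel_measurable_integrable[OF g] by measurable
  show "AE x in M. norm (f x * g x) \<le> norm (of_real B * g x)"
    using order_trans[OF B abs_ge_self] by (auto simp: norm_mult intro!: mult_right_mono)
qed

text \<open>The transform of an integrable function is bounded but may fail to be integrable; the
  Gaussian weight makes it a legitimate input for a second transform.\<close>

lemma integrable_fourier_gauss:
  assumes f: "integrable lborel f" and t: "t > 0"
  shows "integrable lborel (\<lambda>\<xi>. fourier f \<xi> * of_real (gauss (t *\<^sub>R \<xi>)))"
proof (rule integrable_bounded_mult)
  have [measurable]: "f \<in> borel_measurable borel"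
    using assms by (auto intro: borel_measurable_integrable_lborel)
  show "fourier f \<in> borel_measurable lborel" by measurable
  show "integrable lborel (\<lambda>\<xi>. complex_of_real (gauss (t *\<^sub>R \<xi>)))"
    unfolding complex_of_real_integrable_eq by (rule integrable_gauss_scale[OF t])
qed (rule norm_fourier_le[OF f])

text \<open>Smoothing \<open>f\<close> by the kernel amounts to inverting its damped transform, the
  inverse being written as a forward transform at \<open>- x\<close>. The kernel centred at
  \<open>x\<close> is itself the transform of a modulated Gaussian, so the multiplication formula
  applies.\<close>

lemma convolve_gauss_kernel:
  fixes f :: "'a::euclidean_space \<Rightarrow> complex"
  assumes f: "integrable lborel f" and t: "t > 0"
  shows "convolve f (\<lambda>z. of_real (gauss_kernel t z)) x
    = fourier (\<lambda>\<xi>. fourier f \<xi> * of_real (gauss (t *\<^sub>R \<xi>))) (- x)"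
proof -
  have [measurable]: "f \<in> borel_measurable borel"
    using assms by (auto intro: borel_measurable_integrable_lborel)
  let ?g = "\<lambda>\<xi>::'a. of_real (gauss (t *\<^sub>R \<xi>)) * exp (- 2 * of_real pi * \<i> * of_real (\<xi> \<bullet> (- x)))"
  have g: "integrable lborel ?g"
    by (rule integrable_fourier_kernel) (simp only: complex_of_real_integrable_eq integrable_gauss_scale[OF t])
  have "of_real (gauss_kernel t (x - y)) = fourier ?g y" for y
  proof -
    \<comment> \<open>The modulation in \<open>?g\<close> shifts the transform of the Gaussian to
      \<open>y - x\<close>, so evenness of the kernel is used first.\<close>
    have "complex_of_real (gauss_kernel t (x - y)) = of_real (gauss_kernel t (y - x))"
      by (subst gauss_kernel_commute) (rule refl)
    also have "\<dots> = fourier ?g y"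
      by (subst fourier_gauss_scale[OF t, symmetric], subst (1 2) fourier_lborel)
         (auto simp: mult.assoc exp_add[symmetric] algebra_simps)
    finally show ?thesis .
  qed
  then have "convolve f (\<lambda>z. of_real (gauss_kernel t z)) x = (\<integral>y. f y * fourier ?g y \<partial>lborel)"
    by (subst convolve_lborel) auto
  also have "\<dots> = (\<integral>\<xi>. fourier f \<xi> * ?g \<xi> \<partial>lborel)"
    by (rule integral_fourier_mult[OF f g, symmetric])
  also have "\<dots> = fourier (\<lambda>\<xi>. fourier f \<xi> * of_real (gauss (t *\<^sub>R \<xi>))) (- x)"
    by (subst (2) fourier_lborel) (auto simp: mult_ac)
  finally show ?thesis .
qed

lemma measurable_cnj [measurable]: "cnj \<in> borel_measurable borel"
  by (intro borel_measurable_continuous_onI continuous_intros)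

lemma fourier_cnj:
  assumes [measurable]: "f \<in> borel_measurable borel"
  shows "fourier (\<lambda>x. cnj (f x)) \<xi> = cnj (fourier f (- \<xi>))"
  by (subst (1 2) fourier_lborel) (auto simp: Bochner_Integration.integral_cnj[symmetric] exp_cnj simp del: Bochner_Integration.integral_cnj)

text \<open>The weighted energy is the pairing of \<open>f\<close> with its smoothing. Bounding
  |f(x) f(y)| by (|f(x)|^2 + |f(y)|^2) / 2 leaves two equal terms, each half the energy of
  \<open>f\<close> since the kernel has mass 1. The energy of \<open>f\<close> may be infinite, so
  these bounds are taken in [0, \<infinity>].\<close>

lemma nn_integral_fourier_gauss_le:
  fixes f :: "'a::euclidean_space \<Rightarrow> complex"
  assumes f: "integrable lborel f" and t: "t > 0"
  shows "(\<integral>\<^sup>+\<xi>. ennreal ((cmod (fourier f \<xi>))\<^sup>2 * gauss (t *\<^sub>R \<xi>)) \<partial>lborel) \<le> (\<integral>\<^sup>+x. ennreal ((cmod (f x))\<^sup>2) \<partial>lborel)"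
proof -
  have [measurable]: "f \<in> borel_measurable borel"
    using assms by (auto intro: borel_measurable_integrable_lborel)
  let ?h = "\<lambda>\<xi>. fourier f \<xi> * of_real (gauss (t *\<^sub>R \<xi>))"
  let ?c = "convolve f (\<lambda>z. of_real (gauss_kernel t z))"
  have h: "integrable lborel ?h" by (rule integrable_fourier_gauss[OF f t])
  then have h': "integrable lborel (\<lambda>\<xi>. cnj (?h \<xi>))" by (simp only: integrable_cnj)
  have [measurable]: "?h \<in> borel_measurable borel" by measurable
  \<comment> \<open>Conjugation reverses the frequency and so cancels the reflection
    \<open>- x\<close> in \<open>convolve_gauss_kernel\<close>.\<close>
  have c: "fourier (\<lambda>\<xi>. cnj (?h \<xi>)) x = cnj (?c x)" for x
    unfolding convolve_gauss_kernel[OF f t] by (rule fourier_cnj) measurable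
  have int: "integrable lborel (\<lambda>\<xi>. fourier f \<xi> * cnj (?h \<xi>))"
    by (rule integrable_bounded_mult[OF h' _ norm_fourier_le[OF f]]) measurable
  have eq: "fourier f \<xi> * cnj (?h \<xi>) = of_real ((cmod (fourier f \<xi>))\<^sup>2 * gauss (t *\<^sub>R \<xi>))" for \<xi>
    by (simp add: complex_mult_cnj cmod_power2 mult.assoc[symmetric])
  have int': "integrable lborel (\<lambda>\<xi>. (cmod (fourier f \<xi>))\<^sup>2 * gauss (t *\<^sub>R \<xi>))"
    using int unfolding eq complex_of_real_integrable_eq .
  have "(\<integral>\<^sup>+\<xi>. ennreal ((cmod (fourier f \<xi>))\<^sup>2 * gauss (t *\<^sub>R \<xi>)) \<partial>lborel)
    = ennreal (\<integral>\<xi>. (cmod (fourier f \<xi>))\<^sup>2 * gauss (t *\<^sub>R \<xi>) \<partial>lborel)"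
    by (rule nn_integral_eq_integral[OF int']) simp
  also have "(\<integral>\<xi>. (cmod (fourier f \<xi>))\<^sup>2 * gauss (t *\<^sub>R \<xi>) \<partial>lborel) = cmod (\<integral>\<xi>. fourier f \<xi> * cnj (?h \<xi>) \<partial>lborel)"
    unfolding eq integral_complex_of_real by simp
  also have "(\<integral>\<xi>. fourier f \<xi> * cnj (?h \<xi>) \<partial>lborel) = (\<integral>x. f x * cnj (?c x) \<partial>lborel)"
    unfolding c[symmetric] by (rule integral_fourier_mult[OF f h'])
  also have "ennreal (cmod \<dots>) \<le> (\<integral>\<^sup>+x. ennreal (cmod (f x * cnj (?c x))) \<partial>lborel)"
  proof (rule integral_norm_bound_ennreal)
    have "integrable lborel (\<lambda>x. fourier (\<lambda>\<xi>. cnj (?h \<xi>)) x * f x)"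
      by (rule integrable_bounded_mult[OF f _ norm_fourier_le[OF h']]) measurable
    then show "integrable lborel (\<lambda>x. f x * cnj (?c x))" unfolding c by (simp add: mult.commute)
  qed
  also have "\<dots> \<le> (\<integral>\<^sup>+x. \<integral>\<^sup>+y. ennreal (cmod (f x) * cmod (f y) * gauss_kernel t (x - y)) \<partial>lborel \<partial>lborel)"
  proof (rule nn_integral_mono)
    fix x
    have "?c x = (\<integral>y. f y * of_real (gauss_kernel t (x - y)) \<partial>lborel)"
      by (subst convolve_lborel) auto
    moreover have "integrable lborel (\<lambda>y. of_real (gauss_kernel t (x - y)) * f y)"
    proof (rule integrable_bounded_mult[OF f])
      show "cmod (of_real (gauss_kernel t (x - y))) \<le> 1 / t ^ DIM('a)" for y
        unfolding norm_of_real using gauss_le_1[of "(x - y) /\<^sub>R t"] t by (simp add: gauss_kernel_def divide_right_mono)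
    qed measurable
    ultimately have "ennreal (cmod (?c x)) \<le> (\<integral>\<^sup>+y. ennreal (cmod (f y * of_real (gauss_kernel t (x - y)))) \<partial>lborel)"
      by (simp only: mult.commute[of "of_real _"] integral_norm_bound_ennreal)
    then have "ennreal (cmod (f x)) * ennreal (cmod (?c x)) \<le> ennreal (cmod (f x)) * (\<integral>\<^sup>+y. ennreal (cmod (f y * of_real (gauss_kernel t (x - y)))) \<partial>lborel)"
      by (rule mult_left_mono) simp
    then show "ennreal (cmod (f x * cnj (?c x))) \<le> (\<integral>\<^sup>+y. ennreal (cmod (f x) * cmod (f y) * gauss_kernel t (x - y)) \<partial>lborel)"
      using t by (simp add: norm_mult ennreal_mult' nn_integral_cmult gauss_kernel_nonneg mult.assoc)
  qed
  also have "\<dots> \<le> (\<integral>\<^sup>+x. \<integral>\<^sup>+y. (ennreal ((cmod (f x))\<^sup>2 / 2) * ennreal (gauss_kernel t (x - y))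
       + ennreal ((cmod (f y))\<^sup>2 / 2) * ennreal (gauss_kernel t (x - y))) \<partial>lborel \<partial>lborel)"
  proof (intro nn_integral_mono)
    fix x y
    have "cmod (f x) * cmod (f y) \<le> (cmod (f x))\<^sup>2 / 2 + (cmod (f y))\<^sup>2 / 2"
      using sum_squares_bound[of "cmod (f x)" "cmod (f y)"] by simp
    then have "cmod (f x) * cmod (f y) * gauss_kernel t (x - y) \<le> ((cmod (f x))\<^sup>2 / 2 + (cmod (f y))\<^sup>2 / 2) * gauss_kernel t (x - y)"
      by (rule mult_right_mono) (simp add: gauss_kernel_nonneg t)
    then show "ennreal (cmod (f x) * cmod (f y) * gauss_kernel t (x - y)) \<le> ennreal ((cmod (f x))\<^sup>2 / 2) * ennreal (gauss_kernel t (x - y))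
       + ennreal ((cmod (f y))\<^sup>2 / 2) * ennreal (gauss_kernel t (x - y))"
      by (simp add: ennreal_mult'[symmetric] ennreal_plus[symmetric] gauss_kernel_nonneg t distrib_right del: ennreal_plus)
  qed
  also have "\<dots> = (\<integral>\<^sup>+x. \<integral>\<^sup>+y. ennreal ((cmod (f x))\<^sup>2 / 2) * ennreal (gauss_kernel t (x - y)) \<partial>lborel \<partial>lborel)
       + (\<integral>\<^sup>+x. \<integral>\<^sup>+y. ennreal ((cmod (f y))\<^sup>2 / 2) * ennreal (gauss_kernel t (x - y)) \<partial>lborel \<partial>lborel)"
    by (subst nn_integral_add[symmetric]) (auto simp: nn_integral_add)
  \<comment> \<open>Tonelli's theorem brings y outside. In both terms the inner integral is then
    that of the kernel alone, which is 1 around any centre.\<close>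
  also have "(\<integral>\<^sup>+x. \<integral>\<^sup>+y. ennreal ((cmod (f y))\<^sup>2 / 2) * ennreal (gauss_kernel t (x - y)) \<partial>lborel \<partial>lborel)
      = (\<integral>\<^sup>+y. \<integral>\<^sup>+x. ennreal ((cmod (f y))\<^sup>2 / 2) * ennreal (gauss_kernel t (x - y)) \<partial>lborel \<partial>lborel)"
    by (rule lborel_pair.Fubini') measurable
  also have "\<dots> = (\<integral>\<^sup>+y. \<integral>\<^sup>+x. ennreal ((cmod (f y))\<^sup>2 / 2) * ennreal (gauss_kernel t (y - x)) \<partial>lborel \<partial>lborel)"
    by (subst gauss_kernel_commute) (rule refl)
  also have "(\<integral>\<^sup>+x. \<integral>\<^sup>+y. ennreal ((cmod (f x))\<^sup>2 / 2) * ennreal (gauss_kernel t (x - y)) \<partial>lborel \<partial>lborel)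
     = (\<integral>\<^sup>+x. ennreal ((cmod (f x))\<^sup>2 / 2) \<partial>lborel)"
    using nn_integral_lborel_reflect[where 'a='a and f="\<lambda>z. ennreal (gauss_kernel t z)"]
    by (simp add: nn_integral_cmult nn_integral_gauss_kernel[OF t])
  also have "(\<integral>\<^sup>+x. ennreal ((cmod (f x))\<^sup>2 / 2) \<partial>lborel) + (\<integral>\<^sup>+x. ennreal ((cmod (f x))\<^sup>2 / 2) \<partial>lborel)
     = (\<integral>\<^sup>+x. ennreal ((cmod (f x))\<^sup>2) \<partial>lborel)"
    by (subst nn_integral_add[symmetric]) (auto simp: ennreal_plus[symmetric] simp del: ennreal_plus)
  finally show ?thesis .
qed

lemma gauss_tendsto_1:
  "((\<lambda>n. gauss (inverse (real (Suc n)) *\<^sub>R x)) \<longlonglongrightarrow> 1)"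
proof -
  have "(\<lambda>n. gauss (inverse (real (Suc n)) *\<^sub>R x)) \<longlonglongrightarrow> exp (- pi * (norm (0 *\<^sub>R x))\<^sup>2)"
    unfolding gauss_def by (intro tendsto_intros LIMSEQ_inverse_real_of_nat)
  then show ?thesis by simp
qed

text \<open>The Gaussian weights with t = 1 / (n + 1) tend to 1, so Fatou's lemma yields the
  unweighted half of Plancherel's theorem.\<close>

lemma nn_integral_fourier_le:
  assumes f: "integrable lborel f"
  shows "(\<integral>\<^sup>+\<xi>. ennreal ((cmod (fourier f \<xi>))\<^sup>2) \<partial>lborel) \<le> (\<integral>\<^sup>+x. ennreal ((cmod (f x))\<^sup>2) \<partial>lborel)"
proof (rule nn_integral_tendsto_le)
  have [measurable]: "f \<in> borel_measurable borel"
    using assms by (auto intro: borel_measurable_integrable_lborel)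
  fix n
  let ?u = "\<lambda>n \<xi>. ennreal ((cmod (fourier f \<xi>))\<^sup>2 * gauss (inverse (real (Suc n)) *\<^sub>R \<xi>))"
  show "?u n \<in> borel_measurable lborel" by measurable
  show "AE \<xi> in lborel. (\<lambda>n. ?u n \<xi>) \<longlonglongrightarrow> ennreal ((cmod (fourier f \<xi>))\<^sup>2)"
  proof (rule AE_I2)
    fix \<xi>
    have "(\<lambda>n. ?u n \<xi>) \<longlonglongrightarrow> ennreal ((cmod (fourier f \<xi>))\<^sup>2 * 1)"
      by (intro tendsto_ennrealI tendsto_mult tendsto_const gauss_tendsto_1)
    then show "(\<lambda>n. ?u n \<xi>) \<longlonglongrightarrow> ennreal ((cmod (fourier f \<xi>))\<^sup>2)" by simp
  qed
  show "(\<integral>\<^sup>+\<xi>. ?u n \<xi> \<partial>lborel) \<le> (\<integral>\<^sup>+x. ennreal ((cmod (f x))\<^sup>2) \<partial>lborel)"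
    by (rule nn_integral_fourier_gauss_le[OF f]) simp
qed

text \<open>The approximate identity, pointwise. After rescaling by t the Gaussian weight no longer
  depends on t and the dilation sits inside \<open>f\<close>, so continuity gives the limit of the
  integrand and \<open>B * gauss z\<close> dominates it.\<close>

lemma convolve_gauss_kernel_tendsto:
  fixes f :: "'a::euclidean_space \<Rightarrow> complex"
  assumes cont: "continuous_on UNIV f" and B: "\<And>x. cmod (f x) \<le> B"
  shows "(\<lambda>n. convolve f (\<lambda>z. of_real (gauss_kernel (inverse (real (Suc n))) z)) x) \<longlonglongrightarrow> f x"
proof -
  have [measurable]: "f \<in> borel_measurable borel" by (rule borel_measurable_continuous_onI[OF cont])
  let ?t = "\<lambda>n. inverse (real (Suc n))"
  have eq: "convolve f (\<lambda>z. of_real (gauss_kernel t z)) x = (\<integral>z. f (x - t *\<^sub>R z) * of_real (gauss z) \<partial>lborel)" if t: "t > 0" for t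
  proof -
    have "convolve f (\<lambda>z. of_real (gauss_kernel t z)) x = (\<integral>y. f y * of_real (gauss_kernel t (x - y)) \<partial>lborel)"
      by (subst convolve_lborel) auto
    also have "\<dots> = (\<integral>y. f (x - y) * of_real (gauss_kernel t y) \<partial>lborel)"
      by (subst integral_lborel_reflect[of _ x, symmetric]) auto
    also have "\<dots> = (t ^ DIM('a)) *\<^sub>R (\<integral>z. f (x - t *\<^sub>R z) * of_real (gauss_kernel t (t *\<^sub>R z)) \<partial>lborel)"
      by (rule integral_lborel_scale[OF t]) measurable
    also have "\<dots> = (\<integral>z. (t ^ DIM('a)) *\<^sub>R (f (x - t *\<^sub>R z) * of_real (gauss_kernel t (t *\<^sub>R z))) \<partial>lborel)"
      by simp
    also have "\<dots> = (\<integral>z. f (x - t *\<^sub>R z) * of_real (gauss z) \<partial>lborel)"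
      using t by (intro Bochner_Integration.integral_cong) (auto simp: gauss_kernel_def scaleR_conv_of_real)
    finally show ?thesis .
  qed
  have "(\<lambda>n. \<integral>z. f (x - ?t n *\<^sub>R z) * of_real (gauss z) \<partial>lborel) \<longlonglongrightarrow> (\<integral>z. f x * of_real (gauss (z::'a)) \<partial>lborel)"
  proof (rule integral_dominated_convergence[where w = "\<lambda>z::'a. B * gauss z"])
    show "integrable lborel (\<lambda>z::'a. B * gauss z)" by (intro integrable_mult_right integrable_gauss)
    show "AE z in lborel. (\<lambda>n. f (x - ?t n *\<^sub>R z) * of_real (gauss z)) \<longlonglongrightarrow> f x * of_real (gauss z)"
    proof (rule AE_I2)
      fix z
      have "(\<lambda>n. x - ?t n *\<^sub>R z) \<longlonglongrightarrow> x - 0 *\<^sub>R z"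
        by (intro tendsto_intros LIMSEQ_inverse_real_of_nat)
      then have "(\<lambda>n. f (x - ?t n *\<^sub>R z)) \<longlonglongrightarrow> f (x - 0 *\<^sub>R z)"
        using cont by (intro isCont_tendsto_compose[of _ f]) (auto simp: continuous_on_eq_continuous_at)
      then show "(\<lambda>n. f (x - ?t n *\<^sub>R z) * of_real (gauss z)) \<longlonglongrightarrow> f x * of_real (gauss z)"
        by (intro tendsto_intros) simp
    qed
    show "AE z in lborel. norm (f (x - ?t n *\<^sub>R z) * of_real (gauss z)) \<le> B * gauss z" for n
      using B by (intro AE_I2) (auto simp: norm_mult intro!: mult_right_mono)
  qed measurable
  also have "(\<integral>z. f x * of_real (gauss (z::'a)) \<partial>lborel) = f x"
    by (simp add: integral_gauss)
  finally show ?thesis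
    by (simp only: eq inverse_positive_iff_positive of_nat_0_less_iff zero_less_Suc)
qed

text \<open>The reverse inequality: \<open>nn_integral_fourier_le\<close> is applied to the damped
  transform of \<open>f\<close>, whose own transform is a smoothing of \<open>f\<close> up to
  reflection. The smoothings converge pointwise for continuous bounded \<open>f\<close>, and Fatou's
  lemma concludes.\<close>

lemma nn_integral_le_fourier:
  fixes f :: "'a::euclidean_space \<Rightarrow> complex"
  assumes f: "integrable lborel f" and cont: "continuous_on UNIV f" and B: "\<And>x. cmod (f x) \<le> B"
  shows "(\<integral>\<^sup>+x. ennreal ((cmod (f x))\<^sup>2) \<partial>lborel) \<le> (\<integral>\<^sup>+\<xi>. ennreal ((cmod (fourier f \<xi>))\<^sup>2) \<partial>lborel)"
proof (rule nn_integral_tendsto_le)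
  have [measurable]: "f \<in> borel_measurable borel"
    using assms by (auto intro: borel_measurable_integrable_lborel)
  fix n
  let ?t = "\<lambda>n. inverse (real (Suc n))"
  let ?h = "\<lambda>\<xi>. fourier f \<xi> * of_real (gauss (?t n *\<^sub>R \<xi>))"
  let ?u = "\<lambda>n x. ennreal ((cmod (convolve f (\<lambda>z. of_real (gauss_kernel (?t n) z)) x))\<^sup>2)"
  have t: "?t n > 0" by simp
  have h: "integrable lborel ?h" by (rule integrable_fourier_gauss[OF f t])
  have [measurable]: "?h \<in> borel_measurable borel" by measurable
  \<comment> \<open>Written with \<open>0 - x\<close> so that
    \<open>nn_integral_lborel_reflect\<close> matches.\<close>
  have u: "?u n x = ennreal ((cmod (fourier ?h (0 - x)))\<^sup>2)" for x
    unfolding convolve_gauss_kernel[OF f t] by simp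
  show "?u n \<in> borel_measurable lborel" unfolding u by measurable
  show "AE x in lborel. (\<lambda>n. ?u n x) \<longlonglongrightarrow> ennreal ((cmod (f x))\<^sup>2)"
    by (intro AE_I2 ennreal_power2_tendsto convolve_gauss_kernel_tendsto[OF cont B])
  have "(\<integral>\<^sup>+x. ?u n x \<partial>lborel) = (\<integral>\<^sup>+x. ennreal ((cmod (fourier ?h x))\<^sup>2) \<partial>lborel)"
    unfolding u by (rule nn_integral_lborel_reflect) measurable
  also have "\<dots> \<le> (\<integral>\<^sup>+\<xi>. ennreal ((cmod (?h \<xi>))\<^sup>2) \<partial>lborel)"
    by (rule nn_integral_fourier_le[OF h])
  also have "\<dots> \<le> (\<integral>\<^sup>+\<xi>. ennreal ((cmod (fourier f \<xi>))\<^sup>2) \<partial>lborel)"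
    by (intro nn_integral_mono ennreal_leI power_mono) (auto simp: norm_mult gauss_le_1 mult_left_le)
  finally show "(\<integral>\<^sup>+x. ?u n x \<partial>lborel) \<le> (\<integral>\<^sup>+\<xi>. ennreal ((cmod (fourier f \<xi>))\<^sup>2) \<partial>lborel)" .
qed

subsection \<open>Convolution\<close>

text \<open>Translation invariance makes the inner integral of |h(y) k(x - y)| over x equal to
  |h(y)| times the L1 norm of \<open>k\<close>.\<close>

lemma integrable_lborel_pair_convolve:
  fixes h k :: "'a::euclidean_space \<Rightarrow> complex"
  assumes h: "integrable lborel h" and k: "integrable lborel k"
  shows "integrable (lborel \<Otimes>\<^sub>M lborel) (\<lambda>(y, x). h y * k (x - y))"
proof (rule lborel_pair.Fubini_integrable)
  have [measurable]: "h \<in> borel_measurable borel" "k \<in> borel_measurable borel"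
    using assms by (auto intro: borel_measurable_integrable_lborel)
  have shift: "distr lborel borel (\<lambda>x. x - y) = lborel" for y :: 'a
    by (rule lborel_distr_shift)
  have I: "integrable lborel (\<lambda>x. k (x - y))" for y
    using k by (subst integrable_distr_eq[of "\<lambda>x. x - y" lborel borel k, symmetric]) (auto simp: shift)
  have J: "(\<integral>x. cmod (k (x - y)) \<partial>lborel) = (\<integral>x. cmod (k x) \<partial>lborel)" for y
    by (subst (2) shift[of y, symmetric]) (simp add: integral_distr)
  show "(\<lambda>(y, x). h y * k (x - y)) \<in> borel_measurable (lborel \<Otimes>\<^sub>M lborel)" by measurable
  show "integrable lborel (\<lambda>y. \<integral>x. norm (case (y, x) of (y, x) \<Rightarrow> h y * k (x - y)) \<partial>lborel)"
    using h by (simp add: norm_mult J)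
  show "AE y in lborel. integrable lborel (\<lambda>x. case (y, x) of (y, x) \<Rightarrow> h y * k (x - y))"
    using I by simp
qed

lemma
  fixes h k :: "'a::euclidean_space \<Rightarrow> complex"
  assumes h: "integrable lborel h" and k: "integrable lborel k"
  shows integrable_convolve: "integrable lborel (convolve h k)"
    and fourier_convolve: "fourier (convolve h k) \<xi> = fourier h \<xi> * fourier k \<xi>"
proof -
  have [measurable]: "h \<in> borel_measurable borel" "k \<in> borel_measurable borel"
    using assms by (auto intro: borel_measurable_integrable_lborel)
  have eq: "convolve h k = (\<lambda>x. \<integral>y. h y * k (x - y) \<partial>lborel)"
    by (rule ext, rule convolve_lborel) measurable
  note int = integrable_lborel_pair_convolve[OF h k]
  show "integrable lborel (convolve h k)"
    unfolding eq using lborel_pair.integrable_snd[OF int] .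
  let ?e = "\<lambda>x. exp (- 2 * of_real pi * \<i> * of_real (x \<bullet> \<xi>))"
  have [measurable]: "convolve h k \<in> borel_measurable borel"
    unfolding eq by measurable
  have int': "integrable (lborel \<Otimes>\<^sub>M lborel) (\<lambda>(y, x). h y * k (x - y) * ?e x)"
  proof (rule Bochner_Integration.integrable_bound[OF int])
    show "(\<lambda>(y, x). h y * k (x - y) * ?e x) \<in> borel_measurable (lborel \<Otimes>\<^sub>M lborel)" by measurable
  qed (auto simp: norm_mult)
  have "fourier (convolve h k) \<xi> = (\<integral>x. (\<integral>y. h y * k (x - y) * ?e x \<partial>lborel) \<partial>lborel)"
    by (subst fourier_lborel) (auto simp: eq)
  also have "\<dots> = (\<integral>y. (\<integral>x. h y * k (x - y) * ?e x \<partial>lborel) \<partial>lborel)"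
    by (rule lborel_pair.Fubini_integral[OF int'])
  also have "\<dots> = (\<integral>y. h y * ?e y * fourier k \<xi> \<partial>lborel)"
  proof (intro Bochner_Integration.integral_cong refl)
    fix y :: 'a
    \<comment> \<open>Substituting \<open>x + y\<close> for \<open>x\<close> splits the exponential
      into a factor that goes with \<open>h\<close> and one that goes with \<open>k\<close>.\<close>
    have shift: "distr lborel borel (\<lambda>x. x + y) = lborel"
      using lborel_distr_shift[of "- y"] by simp
    have e: "?e (x + y) = ?e y * ?e x" for x
      by (simp add: inner_add_left exp_add[symmetric] algebra_simps)
    have "(\<integral>x. h y * k (x - y) * ?e x \<partial>lborel) = (\<integral>x. h y * k x * ?e (x + y) \<partial>lborel)"
      by (subst shift[symmetric], subst integral_distr) auto
    also have "\<dots> = (\<integral>x. (h y * ?e y) * (k x * ?e x) \<partial>lborel)"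
      by (intro Bochner_Integration.integral_cong refl) (simp only: e, simp only: mult_ac)
    also have "\<dots> = h y * ?e y * fourier k \<xi>"
      by (subst fourier_lborel) auto
    finally show "(\<integral>x. h y * k (x - y) * ?e x \<partial>lborel) = h y * ?e y * fourier k \<xi>" .
  qed
  also have "\<dots> = fourier h \<xi> * fourier k \<xi>"
    by (subst (2) fourier_lborel) auto
  finally show "fourier (convolve h k) \<xi> = fourier h \<xi> * fourier k \<xi>" .
qed

text \<open>After reflecting y to x - y the point x enters only through the bounded continuous
  factor \<open>h\<close>. The majorant \<open>B * cmod (k y)\<close> then serves both for the bound
  and for the dominated convergence behind continuity.\<close>

lemma
  fixes h k :: "'a::euclidean_space \<Rightarrow> complex"
  assumes cont: "continuous_on UNIV h" and B: "\<And>x. cmod (h x) \<le> B" and k: "integrable lborel k"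
  shows norm_convolve_le: "cmod (convolve h k x) \<le> B * (\<integral>y. cmod (k y) \<partial>lborel)"
    and continuous_on_convolve: "continuous_on UNIV (convolve h k)"
proof -
  have [measurable]: "h \<in> borel_measurable borel" "k \<in> borel_measurable borel"
    using k borel_measurable_continuous_onI[OF cont] by (auto intro: borel_measurable_integrable_lborel)
  have eq: "convolve h k x = (\<integral>y. h (x - y) * k y \<partial>lborel)" for x
    by (subst integral_lborel_reflect[of _ x, symmetric]) (auto simp: convolve_lborel)
  have le: "cmod (h (x - y) * k y) \<le> B * cmod (k y)" for x y
    using B by (auto simp: norm_mult intro!: mult_right_mono)
  have "cmod (convolve h k x) \<le> (\<integral>y. cmod (h (x - y) * k y) \<partial>lborel)"
    unfolding eq by (rule integral_norm_bound)
  also have "\<dots> \<le> (\<integral>y. B * cmod (k y) \<partial>lborel)"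
    using k by (intro integral_mono integrable_norm integrable_bounded_mult[OF k _ B] le) auto
  finally show "cmod (convolve h k x) \<le> B * (\<integral>y. cmod (k y) \<partial>lborel)" by simp
  have "isCont (convolve h k) x" for x
    unfolding continuous_at_sequentially
  proof safe
    fix X :: "nat \<Rightarrow> 'a" assume X: "X \<longlonglongrightarrow> x"
    have "(\<lambda>n. \<integral>y. h (X n - y) * k y \<partial>lborel) \<longlonglongrightarrow> (\<integral>y. h (x - y) * k y \<partial>lborel)"
    proof (rule integral_dominated_convergence[where w = "\<lambda>y. B * cmod (k y)"])
      show "integrable lborel (\<lambda>y. B * cmod (k y))" using k by simp
      show "AE y in lborel. (\<lambda>n. h (X n - y) * k y) \<longlonglongrightarrow> h (x - y) * k y"
        using cont X by (intro AE_I2 tendsto_intros isCont_tendsto_compose[of _ h]) (auto simp: continuous_on_eq_continuous_at)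
    qed (use le in auto)
    then show "(convolve h k \<circ> X) \<longlonglongrightarrow> convolve h k x"
      by (simp add: eq o_def)
  qed
  then show "continuous_on UNIV (convolve h k)"
    by (simp add: continuous_on_eq_continuous_at)
qed

lemma nn_integral_convolve_le:
  fixes h k :: "'a::euclidean_space \<Rightarrow> complex"
  assumes h: "integrable lborel h" and cont: "continuous_on UNIV h" and B: "\<And>x. cmod (h x) \<le> B"
    and k: "integrable lborel k"
  shows "(\<integral>\<^sup>+x. ennreal ((cmod (convolve h k x))\<^sup>2) \<partial>lborel)
     \<le> (\<integral>\<^sup>+\<xi>. ennreal ((cmod (fourier h \<xi>))\<^sup>2) * ennreal ((cmod (fourier k \<xi>))\<^sup>2) \<partial>lborel)"
  using nn_integral_le_fourier[OF integrable_convolve[OF h k] continuous_on_convolve[OF cont B k] norm_convolve_le[OF cont B k]]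
  by (simp add: fourier_convolve[OF h k] norm_mult power_mult_distrib ennreal_mult)

text \<open>The two Plancherel inequalities are used in opposite directions: for the convolutions
  space is bounded by frequency, for \<open>h\<close> frequency by space. In between, the bound on
  the sum of squared transforms is inserted at almost every frequency.\<close>

lemma sum_nn_integral_convolve_le:
  fixes h :: "'a::euclidean_space \<Rightarrow> complex"
  assumes h: "integrable lborel h" and cont: "continuous_on UNIV h" and B: "\<And>x. cmod (h x) \<le> B"
    and k: "\<And>i. i \<in> I \<Longrightarrow> integrable lborel (k i)"
    and C: "AE \<xi> in lborel. (\<Sum>i\<in>I. ennreal ((cmod (fourier (k i) \<xi>))\<^sup>2)) \<le> C"
  shows "(\<Sum>i\<in>I. \<integral>\<^sup>+x. ennreal ((cmod (convolve h (k i) x))\<^sup>2) \<partial>lborel)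
     \<le> C * (\<integral>\<^sup>+x. ennreal ((cmod (h x))\<^sup>2) \<partial>lborel)"
proof -
  have [measurable]: "h \<in> borel_measurable borel" "\<And>i. i \<in> I \<Longrightarrow> k i \<in> borel_measurable borel"
    using h k by (auto intro: borel_measurable_integrable_lborel)
  have "(\<Sum>i\<in>I. \<integral>\<^sup>+x. ennreal ((cmod (convolve h (k i) x))\<^sup>2) \<partial>lborel)
    \<le> (\<Sum>i\<in>I. \<integral>\<^sup>+\<xi>. ennreal ((cmod (fourier h \<xi>))\<^sup>2) * ennreal ((cmod (fourier (k i) \<xi>))\<^sup>2) \<partial>lborel)"
    by (intro sum_mono nn_integral_convolve_le[OF h cont B] k)
  also have "\<dots> = (\<integral>\<^sup>+\<xi>. (\<Sum>i\<in>I. ennreal ((cmod (fourier h \<xi>))\<^sup>2) * ennreal ((cmod (fourier (k i) \<xi>))\<^sup>2)) \<partial>lborel)"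
    by (rule nn_integral_sum[symmetric]) measurable
  also have "\<dots> \<le> (\<integral>\<^sup>+\<xi>. C * ennreal ((cmod (fourier h \<xi>))\<^sup>2) \<partial>lborel)"
    using C by (intro nn_integral_mono_AE) (auto elim!: eventually_mono simp: sum_distrib_left[symmetric] mult.commute[of C] intro!: mult_left_mono)
  also have "\<dots> = C * (\<integral>\<^sup>+\<xi>. ennreal ((cmod (fourier h \<xi>))\<^sup>2) \<partial>lborel)"
    by (rule nn_integral_cmult) measurable
  also have "\<dots> \<le> C * (\<integral>\<^sup>+x. ennreal ((cmod (h x))\<^sup>2) \<partial>lborel)"
    by (intro mult_left_mono nn_integral_fourier_le h) simp
  finally show ?thesis .
qed

section \<open>Square-integrable signals and Lebesgue measurable filters\<close>

lemma lebesgue_measurable_borel_representative: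
  fixes f :: "'a::euclidean_space \<Rightarrow> complex"
  assumes [measurable]: "f \<in> borel_measurable lebesgue"
  obtains f' where "f' \<in> borel_measurable borel" "AE x in lebesgue. f x = f' x"
proof -
  have "(\<lambda>x. Re (f x)) \<in> borel_measurable lebesgue" "(\<lambda>x. Im (f x)) \<in> borel_measurable lebesgue"
    by measurable
  then obtain r s where rs: "r \<in> borel_measurable lborel" "s \<in> borel_measurable lborel"
    "AE x in lborel. Re (f x) = r x" "AE x in lborel. Im (f x) = s x"
    using completion_ex_borel_measurable_real by metis
  show ?thesis
  proof
    show "(\<lambda>x. Complex (r x) (s x)) \<in> borel_measurable borel"
      using rs(1,2) by (simp add: borel_measurable_complex_iff)
    have "AE x in lborel. f x = Complex (r x) (s x)"
      using rs(3,4) by eventually_elim (simp add: complex_eq_iff)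
    then show "AE x in lebesgue. f x = Complex (r x) (s x)" by (rule AE_completion)
  qed
qed

lemma measurable_lebesgue_reflect:
  "f \<in> borel_measurable lebesgue \<Longrightarrow> (\<lambda>y. f (a - y)) \<in> borel_measurable lebesgue"
  using measurable_compose[OF lebesgue_distr_reflect(1)] .

lemma AE_lebesgue_reflect:
  fixes a :: "'a::euclidean_space"
  assumes "AE y in lebesgue. P y"
  shows "AE y in lebesgue. P (a - y)"
proof -
  have "AE y in distr lebesgue lebesgue (\<lambda>y. a - y). P y"
    using assms unfolding lebesgue_distr_reflect(2) .
  then show ?thesis
    by (rule AE_distrD[OF lebesgue_distr_reflect(1)])
qed

lemma integrable_lebesgue_reflect:
  fixes a :: "'a::euclidean_space" and f :: "'a \<Rightarrow> 'b::{banach, second_countable_topology}"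
  assumes "integrable lebesgue f"
  shows "integrable lebesgue (\<lambda>y. f (a - y))"
proof -
  have "integrable (distr lebesgue lebesgue (\<lambda>y. a - y)) f"
    using assms unfolding lebesgue_distr_reflect(2) .
  then show ?thesis
    by (rule integrable_distr[OF lebesgue_distr_reflect(1)])
qed

lemma in_L2_reflect: "in_L2 f \<Longrightarrow> in_L2 (\<lambda>y. f (a - y))"
  unfolding in_L2_def
  using measurable_lebesgue_reflect[of f a] integrable_lebesgue_reflect[of "\<lambda>x. (cmod (f x))\<^sup>2" a] by auto

lemma integrable_mult_square_integrable:
  fixes f g :: "'a \<Rightarrow> complex"
  assumes f: "f \<in> borel_measurable M" "integrable M (\<lambda>x. (cmod (f x))\<^sup>2)"
    and g: "g \<in> borel_measurable M" "integrable M (\<lambda>x. (cmod (g x))\<^sup>2)"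
  shows "integrable M (\<lambda>x. f x * g x)"
proof (rule Bochner_Integration.integrable_bound)
  show "integrable M (\<lambda>x. (cmod (f x))\<^sup>2 + (cmod (g x))\<^sup>2)" using f g by simp
  show "(\<lambda>x. f x * g x) \<in> borel_measurable M" using f(1) g(1) by measurable
  have "cmod a * cmod b \<le> (cmod a)\<^sup>2 + (cmod b)\<^sup>2" for a b
    using sum_squares_bound[of "cmod a" "cmod b"] zero_le_power2[of "cmod a"] zero_le_power2[of "cmod b"]
      mult_nonneg_nonneg[of "cmod a" "cmod b"] by linarith
  then show "AE x in M. norm (f x * g x) \<le> norm ((cmod (f x))\<^sup>2 + (cmod (g x))\<^sup>2)"
    by (simp add: norm_mult)
qed

text \<open>For two L2 functions the integral defining the convolution converges at every
  \<open>x\<close>, so \<open>convolve\<close> never falls back on the default value 0 of a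
  divergent integral.\<close>

lemma integrable_convolve_integrand:
  assumes "in_L2 h" "in_L2 k"
  shows "integrable lebesgue (\<lambda>y. h y * k (x - y))"
  using assms in_L2_reflect[OF assms(2), of x] unfolding in_L2_def
  by (intro integrable_mult_square_integrable) auto

text \<open>Measurability is carried along since Fatou's lemma needs it when passing to limits in \<open>h\<close>.\<close>

definition bessel_bound :: "'i set \<Rightarrow> ('i \<Rightarrow> 'a::euclidean_space \<Rightarrow> complex) \<Rightarrow> ennreal \<Rightarrow> ('a \<Rightarrow> complex) \<Rightarrow> bool" where
  "bessel_bound I k C h \<longleftrightarrow> (\<forall>i\<in>I. convolve h (k i) \<in> borel_measurable lebesgue) \<and>
    (\<integral>\<^sup>+x. (\<Sum>i\<in>I. ennreal ((cmod (convolve h (k i) x))\<^sup>2)) \<partial>lebesgue) \<le> C * (\<integral>\<^sup>+x. ennreal ((cmod (h x))\<^sup>2) \<partial>lebesgue)"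

text \<open>The filters are replaced by Borel representatives \<open>k'\<close>. This changes
  neither their transforms nor the convolutions at any point, so the estimate for
  \<open>lborel\<close> carries over.\<close>

lemma bessel_bound_continuous:
  fixes h :: "'a::euclidean_space \<Rightarrow> complex"
  assumes h: "integrable lborel h" and cont: "continuous_on UNIV h" and B: "\<And>x. cmod (h x) \<le> B"
    and k: "\<And>i. i \<in> I \<Longrightarrow> in_L1 (k i)"
    and C: "AE \<xi> in lebesgue. (\<Sum>i\<in>I. ennreal ((cmod (fourier (k i) \<xi>))\<^sup>2)) \<le> C"
  shows "bessel_bound I k C h"
proof -
  have h_borel [measurable]: "h \<in> borel_measurable borel"
    using h by (auto intro: borel_measurable_integrable_lborel)
  have h_leb [measurable]: "h \<in> borel_measurable lebesgue"
    by (rule measurable_completion) simp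
  have "\<exists>k'. k' \<in> borel_measurable borel \<and> (AE x in lebesgue. k i x = k' x)" if "i \<in> I" for i
    using k[OF that] lebesgue_measurable_borel_representative[of "k i"]
    unfolding in_L1_def by (metis borel_measurable_integrable)
  then obtain k' where k'_borel [measurable]: "\<And>i. i \<in> I \<Longrightarrow> k' i \<in> borel_measurable borel"
    and k': "\<And>i. i \<in> I \<Longrightarrow> AE x in lebesgue. k i x = k' i x"
    by metis
  have k_leb [measurable]: "k i \<in> borel_measurable lebesgue" if "i \<in> I" for i
    using k[OF that] unfolding in_L1_def by (rule borel_measurable_integrable)
  have k'_leb [measurable]: "k' i \<in> borel_measurable lebesgue" if "i \<in> I" for i
    by (rule measurable_completion) (use k'_borel[OF that] in simp)
  have k'_int: "integrable lborel (k' i)" if "i \<in> I" for i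
  proof -
    have "integrable lebesgue (k' i)"
      using k[OF that] k'[OF that] unfolding in_L1_def
      by (subst integrable_cong_AE[where g = "k i"]) (auto simp: that elim: eventually_mono)
    then show ?thesis using k'_borel[OF that] by (simp add: integrable_completion)
  qed
  have f: "fourier (k i) \<xi> = fourier (k' i) \<xi>" if "i \<in> I" for i \<xi>
    unfolding fourier_def
  proof (rule integral_cong_AE)
    have "(\<lambda>x. exp (- 2 * complex_of_real pi * \<i> * complex_of_real (x \<bullet> \<xi>))) \<in> borel_measurable lebesgue"
      by (rule measurable_completion) measurable
    then show "(\<lambda>x. k i x * exp (- 2 * of_real pi * \<i> * of_real (x \<bullet> \<xi>))) \<in> borel_measurable lebesgue"
      "(\<lambda>x. k' i x * exp (- 2 * of_real pi * \<i> * of_real (x \<bullet> \<xi>))) \<in> borel_measurable lebesgue"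
      using k_leb[OF that] k'_leb[OF that] by measurable
    show "AE x in lebesgue. k i x * exp (- 2 * of_real pi * \<i> * of_real (x \<bullet> \<xi>)) = k' i x * exp (- 2 * of_real pi * \<i> * of_real (x \<bullet> \<xi>))"
      using k'[OF that] by eventually_elim simp
  qed
  \<comment> \<open>Equality holds at every \<open>x\<close>, since the reflection of y to x - y
    preserves null sets.\<close>
  have c: "convolve h (k i) = convolve h (k' i)" if "i \<in> I" for i
  proof
    fix x
    note [measurable] = measurable_lebesgue_reflect[OF k_leb[OF that], of x] measurable_lebesgue_reflect[OF k'_leb[OF that], of x]
    show "convolve h (k i) x = convolve h (k' i) x"
      unfolding convolve_def
    proof (rule integral_cong_AE)
      show "AE y in lebesgue. h y * k i (x - y) = h y * k' i (x - y)"
        using AE_lebesgue_reflect[OF k'[OF that], of x] by eventually_elim simp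
    qed measurable
  qed
  have c_borel: "convolve h (k' i) \<in> borel_measurable borel" if "i \<in> I" for i
    using integrable_convolve[OF h k'_int[OF that]] by (rule borel_measurable_integrable_lborel)
  have C': "AE \<xi> in lborel. (\<Sum>i\<in>I. ennreal ((cmod (fourier (k' i) \<xi>))\<^sup>2)) \<le> C"
    using C by (simp add: AE_completion_iff f)
  have "(\<integral>\<^sup>+x. (\<Sum>i\<in>I. ennreal ((cmod (convolve h (k' i) x))\<^sup>2)) \<partial>lborel)
      = (\<Sum>i\<in>I. \<integral>\<^sup>+x. ennreal ((cmod (convolve h (k' i) x))\<^sup>2) \<partial>lborel)"
    using c_borel by (intro nn_integral_sum) auto
  also have "\<dots> \<le> C * (\<integral>\<^sup>+x. ennreal ((cmod (h x))\<^sup>2) \<partial>lborel)"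
    by (rule sum_nn_integral_convolve_le[OF h cont B k'_int C'])
  finally show ?thesis
    using c_borel by (auto simp: bessel_bound_def nn_integral_completion c intro: measurable_completion)
qed

text \<open>The convolutions converge at every point, by dominated convergence with the product of
  \<open>w\<close> and the reflected filter; this also transfers measurability. Fatou's lemma
  handles the left side of the bound, dominated convergence with the square of \<open>w\<close> the
  right side.\<close>

lemma bessel_bound_limit:
  fixes h :: "'a::euclidean_space \<Rightarrow> complex"
  assumes hn: "\<And>n. hn n \<in> borel_measurable lebesgue" and h: "h \<in> borel_measurable lebesgue"
    and w: "integrable lebesgue (\<lambda>x. (w x)\<^sup>2)" "w \<in> borel_measurable lebesgue"
    and dom: "\<And>n. AE x in lebesgue. cmod (hn n x) \<le> w x"
    and lim: "AE x in lebesgue. (\<lambda>n. hn n x) \<longlonglongrightarrow> h x"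
    and k: "\<And>i. i \<in> I \<Longrightarrow> in_L2 (k i)"
    and C: "C < \<infinity>"
    and bb: "\<And>n. bessel_bound I k C (hn n)"
  shows "bessel_bound I k C h"
proof -
  have w2: "in_L2 (\<lambda>x. of_real (w x))"
    using w by (simp add: in_L2_def)
  have conv: "(\<lambda>n. convolve (hn n) (k i) x) \<longlonglongrightarrow> convolve h (k i) x" if i: "i \<in> I" for i x
    unfolding convolve_def
  proof (rule integral_dominated_convergence[where w = "\<lambda>y. norm (of_real (w y) * k i (x - y))"])
    have kx: "(\<lambda>y. k i (x - y)) \<in> borel_measurable lebesgue"
      using k[OF i] by (intro measurable_lebesgue_reflect) (simp add: in_L2_def)
    show "(\<lambda>y. h y * k i (x - y)) \<in> borel_measurable lebesgue" using kx h by measurable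
    show "(\<lambda>y. hn n y * k i (x - y)) \<in> borel_measurable lebesgue" for n using kx hn[of n] by measurable
    show "integrable lebesgue (\<lambda>y. norm (of_real (w y) * k i (x - y)))"
      by (intro integrable_norm integrable_convolve_integrand[OF w2] k i)
    show "AE y in lebesgue. (\<lambda>n. hn n y * k i (x - y)) \<longlonglongrightarrow> h y * k i (x - y)"
      using lim by eventually_elim (intro tendsto_intros)
    show "AE y in lebesgue. norm (hn n y * k i (x - y)) \<le> norm (of_real (w y) * k i (x - y))" for n
      using dom[of n] by eventually_elim (auto simp: norm_mult intro!: mult_right_mono)
  qed
  have meas: "convolve (hn n) (k i) \<in> borel_measurable lebesgue" if "i \<in> I" for n i
    using bb[of n] that by (simp add: bessel_bound_def)
  have meas': "convolve h (k i) \<in> borel_measurable lebesgue" if "i \<in> I" for i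
    by (rule borel_measurable_LIMSEQ_metric[OF meas[OF that] conv[OF that]])
  have lim_h: "(\<lambda>n. \<integral>\<^sup>+x. ennreal ((cmod (hn n x))\<^sup>2) \<partial>lebesgue) \<longlonglongrightarrow> (\<integral>\<^sup>+x. ennreal ((cmod (h x))\<^sup>2) \<partial>lebesgue)"
  proof (rule nn_integral_dominated_convergence[where w = "\<lambda>x. ennreal ((w x)\<^sup>2)"])
    show "(\<lambda>x. ennreal ((cmod (hn n x))\<^sup>2)) \<in> borel_measurable lebesgue" for n using hn[of n] by measurable
    show "(\<lambda>x. ennreal ((cmod (h x))\<^sup>2)) \<in> borel_measurable lebesgue" using h by measurable
    show "(\<lambda>x. ennreal ((w x)\<^sup>2)) \<in> borel_measurable lebesgue" using w by measurable
    show "(\<integral>\<^sup>+x. ennreal ((w x)\<^sup>2) \<partial>lebesgue) < \<infinity>"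
      using w(1) by (subst nn_integral_eq_integral) auto
    show "AE x in lebesgue. (\<lambda>n. ennreal ((cmod (hn n x))\<^sup>2)) \<longlonglongrightarrow> ennreal ((cmod (h x))\<^sup>2)"
      using lim by eventually_elim (rule ennreal_power2_tendsto)
    show "AE x in lebesgue. ennreal ((cmod (hn n x))\<^sup>2) \<le> ennreal ((w x)\<^sup>2)" for n
      using dom[of n] by eventually_elim (intro ennreal_leI power_mono, auto)
  qed
  let ?S = "\<lambda>h x. \<Sum>i\<in>I. ennreal ((cmod (convolve h (k i) x))\<^sup>2)"
  have "(\<integral>\<^sup>+x. ?S h x \<partial>lebesgue) = (\<integral>\<^sup>+x. liminf (\<lambda>n. ?S (hn n) x) \<partial>lebesgue)"
    by (intro nn_integral_cong lim_imp_Liminf[symmetric] tendsto_sum ennreal_power2_tendsto conv) auto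
  also have "\<dots> \<le> liminf (\<lambda>n. \<integral>\<^sup>+x. ?S (hn n) x \<partial>lebesgue)"
    using meas by (intro nn_integral_liminf borel_measurable_sum) measurable
  also have "\<dots> \<le> liminf (\<lambda>n. C * (\<integral>\<^sup>+x. ennreal ((cmod (hn n x))\<^sup>2) \<partial>lebesgue))"
    using bb by (intro Liminf_mono always_eventually) (auto simp: bessel_bound_def)
  \<comment> \<open>Finiteness of \<open>C\<close> makes multiplication by \<open>C\<close>
    continuous on [0, \<infinity>].\<close>
  also have "\<dots> = C * (\<integral>\<^sup>+x. ennreal ((cmod (h x))\<^sup>2) \<partial>lebesgue)"
    using C by (intro lim_imp_Liminf ennreal_tendsto_cmult lim_h) auto
  finally show ?thesis
    using meas' by (simp add: bessel_bound_def)
qed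

lemma integrable_square_gauss: "integrable lebesgue (\<lambda>x::'a::euclidean_space. (B * gauss x)\<^sup>2)"
proof -
  have "integrable lborel (\<lambda>x::'a. (B * gauss x)\<^sup>2)"
  proof (rule Bochner_Integration.integrable_bound)
    show "integrable lborel (\<lambda>x::'a. B\<^sup>2 * gauss x)" by (intro integrable_mult_right integrable_gauss)
    have "(gauss x)\<^sup>2 \<le> gauss x" for x :: 'a
      using gauss_le_1[of x] by (simp add: power2_eq_square mult_left_le)
    then show "AE x in lborel. norm ((B * gauss (x::'a))\<^sup>2) \<le> norm (B\<^sup>2 * gauss x)"
      by (auto simp: power_mult_distrib abs_mult intro!: mult_left_mono)
  qed measurable
  then show ?thesis by (subst integrable_completion) auto
qed

text \<open>The intermediate class between continuous integrable signals and all of L2: a Gaussian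
  majorant is at once bounded, integrable and square-integrable, so continuous approximants lying
  below it fit both \<open>bessel_bound_continuous\<close> and
  \<open>bessel_bound_limit\<close>.\<close>

lemma bessel_bound_gauss_dominated:
  fixes h :: "'a::euclidean_space \<Rightarrow> complex"
  assumes h: "h \<in> borel_measurable lebesgue" and B: "B > 0" and le: "\<And>x. cmod (h x) \<le> B * gauss x"
    and k: "\<And>i. i \<in> I \<Longrightarrow> in_L1 (k i)" "\<And>i. i \<in> I \<Longrightarrow> in_L2 (k i)"
    and C: "AE \<xi> in lebesgue. (\<Sum>i\<in>I. ennreal ((cmod (fourier (k i) \<xi>))\<^sup>2)) \<le> C" "C < \<infinity>"
  shows "bessel_bound I k C h"
proof -
  have "h measurable_on UNIV" using h by (rule lebesgue_measurable_imp_measurable_on) simp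
  then obtain N g where N: "negligible N" and g: "\<And>n. continuous_on UNIV (g n)"
    and lim: "\<And>x. x \<notin> N \<Longrightarrow> (\<lambda>n. g n x) \<longlonglongrightarrow> h x"
    unfolding measurable_on_def by auto
  \<comment> \<open>continuous in \<open>z\<close>, so clipping the approximants \<open>g n\<close> keeps their limit and makes them dominated\<close>
  define clip :: "'a \<Rightarrow> complex \<Rightarrow> complex"
    where "clip x z = (B * gauss x / max (B * gauss x) (cmod z)) *\<^sub>R z" for x z
  have gauss_pos: "gauss x > 0" for x :: 'a by (simp add: gauss_def)
  have pos: "max (B * gauss x) c > 0" for x :: 'a and c
    using B gauss_pos[of x] by (simp add: less_max_iff_disj)
  have clip_le: "cmod (clip x z) \<le> B * gauss x" for x z
    using B gauss_pos[of x] pos[of x "cmod z"] by (simp add: clip_def divide_le_eq abs_of_pos mult_left_mono)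
  have clip_eq: "clip x z = z" if "cmod z \<le> B * gauss x" for x z
    using that B gauss_pos[of x] by (simp add: clip_def max_absorb1)
  define hn where "hn n x = clip x (g n x)" for n x
  have cont_gauss: "continuous_on UNIV (gauss :: 'a \<Rightarrow> real)"
    unfolding gauss_def by (intro continuous_intros)
  have cont: "continuous_on UNIV (hn n)" for n
    unfolding hn_def clip_def using pos
    by (intro continuous_intros g cont_gauss ballI) (metis less_irrefl)
  have hn_le: "cmod (hn n x) \<le> B * gauss x" for n x
    by (simp add: hn_def clip_le)
  have hn_borel [measurable]: "hn n \<in> borel_measurable borel" for n
    by (rule borel_measurable_continuous_onI[OF cont])
  show ?thesis
  proof (rule bessel_bound_limit[OF _ h integrable_square_gauss[of B]])
    show "hn n \<in> borel_measurable lebesgue" for n by (rule measurable_completion) simp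
    show "(\<lambda>x::'a. B * gauss x) \<in> borel_measurable lebesgue" by (rule measurable_completion) simp
    show "AE x in lebesgue. cmod (hn n x) \<le> B * gauss x" for n using hn_le by simp
    have "(\<lambda>n. hn n x) \<longlonglongrightarrow> h x" if "x \<notin> N" for x
    proof -
      have "(\<lambda>n. clip x (g n x)) \<longlonglongrightarrow> clip x (h x)"
        unfolding clip_def using pos[of x "cmod (h x)"] by (intro tendsto_intros lim that) simp
      then show ?thesis by (simp add: hn_def clip_eq le)
    qed
    then show "AE x in lebesgue. (\<lambda>n. hn n x) \<longlonglongrightarrow> h x"
      using N by (intro AE_I'[of N]) (auto simp: negligible_iff_null_sets)
    show "bessel_bound I k C (hn n)" for n
    proof (rule bessel_bound_continuous[OF _ cont _ k(1) C(1)])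
      show "integrable lborel (hn n)"
      proof (rule Bochner_Integration.integrable_bound)
        show "integrable lborel (\<lambda>x::'a. B * gauss x)" by (intro integrable_mult_right integrable_gauss)
        show "AE x in lborel. norm (hn n x) \<le> norm (B * gauss x)"
          using hn_le B by (simp add: abs_mult)
      qed simp
      show "cmod (hn n x) \<le> B" for x
        using hn_le[of n x] gauss_le_1[of x] B by (smt (verit) mult_left_le)
    qed
  qed (use k C in auto)
qed

text \<open>Truncating \<open>h\<close> to the set where it lies below a multiple of the Gaussian
  reduces to the previous case; \<open>h\<close> itself dominates the truncations in L2.\<close>

lemma bessel_bound_L2:
  fixes h :: "'a::euclidean_space \<Rightarrow> complex"
  assumes h: "in_L2 h"
    and k: "\<And>i. i \<in> I \<Longrightarrow> in_L1 (k i)" "\<And>i. i \<in> I \<Longrightarrow> in_L2 (k i)"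
    and C: "AE \<xi> in lebesgue. (\<Sum>i\<in>I. ennreal ((cmod (fourier (k i) \<xi>))\<^sup>2)) \<le> C" "C < \<infinity>"
  shows "bessel_bound I k C h"
proof -
  \<comment> \<open>\<open>gauss\<close> is positive, so every point is eventually kept;
    \<open>Suc n\<close> keeps the constant positive at n = 0.\<close>
  define hn where "hn n x = (if cmod (h x) \<le> real (Suc n) * gauss x then h x else 0)" for n x
  have [measurable]: "h \<in> borel_measurable lebesgue" using h by (simp add: in_L2_def)
  have gauss_leb [measurable]: "(gauss :: 'a \<Rightarrow> real) \<in> borel_measurable lebesgue"
    by (rule measurable_completion) simp
  have hn_meas: "hn n \<in> borel_measurable lebesgue" for n
    unfolding hn_def by measurable
  show ?thesis
  proof (rule bessel_bound_limit[of hn h "\<lambda>x. cmod (h x)"])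
    show "AE x in lebesgue. cmod (hn n x) \<le> cmod (h x)" for n by (simp add: hn_def)
    have "(\<lambda>n. hn n x) \<longlonglongrightarrow> h x" for x
    proof (rule tendsto_eventually)
      obtain m where m: "cmod (h x) / gauss x \<le> real m" using real_arch_simple by blast
      have "gauss x > 0" by (simp add: gauss_def)
      then have "cmod (h x) \<le> real (Suc n) * gauss x" if "n \<ge> m" for n
        using order_trans[OF m, of "real (Suc n)"] that by (simp add: divide_le_eq)
      then show "\<forall>\<^sub>F n in sequentially. hn n x = h x"
        unfolding eventually_sequentially hn_def by auto
    qed
    then show "AE x in lebesgue. (\<lambda>n. hn n x) \<longlonglongrightarrow> h x" by simp
    show "bessel_bound I k C (hn n)" for n
      by (rule bessel_bound_gauss_dominated[OF hn_meas _ _ k C, of "real (Suc n)"]) (auto simp: hn_def)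
  qed (use h k C hn_meas in \<open>auto simp: in_L2_def\<close>)
qed

section \<open>Translated filters and sums with values in [0, \<infinity>]\<close>

lemma measurable_lebesgue_shift:
  "f \<in> borel_measurable lebesgue \<Longrightarrow> (\<lambda>y. f (y - a)) \<in> borel_measurable lebesgue"
  using measurable_compose[OF lebesgue_distr_shift(1)] .

lemma
  fixes a :: "'a::euclidean_space" and f :: "'a \<Rightarrow> 'b::{banach, second_countable_topology}"
  shows integral_lebesgue_shift: "f \<in> borel_measurable lebesgue \<Longrightarrow> (\<integral>y. f (y - a) \<partial>lebesgue) = (\<integral>y. f y \<partial>lebesgue)"
    and integrable_lebesgue_shift: "integrable lebesgue f \<Longrightarrow> integrable lebesgue (\<lambda>y. f (y - a))"
proof -
  show "(\<integral>y. f (y - a) \<partial>lebesgue) = (\<integral>y. f y \<partial>lebesgue)" if "f \<in> borel_measurable lebesgue"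
    using integral_distr[OF lebesgue_distr_shift(1)[of a] that] unfolding lebesgue_distr_shift(2) by simp
  show "integrable lebesgue (\<lambda>y. f (y - a))" if "integrable lebesgue f"
  proof (rule integrable_distr[OF lebesgue_distr_shift(1)])
    show "integrable (distr lebesgue lebesgue (\<lambda>y. y - a)) f"
      using that unfolding lebesgue_distr_shift(2) .
  qed
qed

lemma in_L1_translate: "in_L1 f \<Longrightarrow> in_L1 (translate c f)"
  unfolding in_L1_def translate_def[abs_def] by (rule integrable_lebesgue_shift)

lemma in_L2_translate: "in_L2 f \<Longrightarrow> in_L2 (translate c f)"
  unfolding in_L2_def translate_def[abs_def]
  using measurable_lebesgue_shift[of f c] integrable_lebesgue_shift[of "\<lambda>x. (cmod (f x))\<^sup>2" c] by auto

lemma in_L2_diff: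
  assumes "in_L2 f" "in_L2 g"
  shows "in_L2 (\<lambda>x. f x - g x)"
  unfolding in_L2_def
proof
  have [measurable]: "f \<in> borel_measurable lebesgue" "g \<in> borel_measurable lebesgue"
    using assms by (auto simp: in_L2_def)
  show meas: "(\<lambda>x. f x - g x) \<in> borel_measurable lebesgue" by measurable
  show "integrable lebesgue (\<lambda>x. (cmod (f x - g x))\<^sup>2)"
  proof (rule Bochner_Integration.integrable_bound)
    show "integrable lebesgue (\<lambda>x. 2 * (cmod (f x))\<^sup>2 + 2 * (cmod (g x))\<^sup>2)"
      using assms by (simp add: in_L2_def)
    show "(\<lambda>x. (cmod (f x - g x))\<^sup>2) \<in> borel_measurable lebesgue" by measurable
    have "(cmod (a - b))\<^sup>2 \<le> 2 * (cmod a)\<^sup>2 + 2 * (cmod b)\<^sup>2" for a b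
    proof -
      have "(cmod (a - b))\<^sup>2 \<le> (cmod a + cmod b)\<^sup>2"
        by (intro power_mono norm_triangle_ineq4) simp
      also have "\<dots> \<le> 2 * (cmod a)\<^sup>2 + 2 * (cmod b)\<^sup>2"
        using sum_squares_bound[of "cmod a" "cmod b"] by (simp add: power2_sum)
      finally show ?thesis .
    qed
    then show "AE x in lebesgue. norm ((cmod (f x - g x))\<^sup>2) \<le> norm (2 * (cmod (f x))\<^sup>2 + 2 * (cmod (g x))\<^sup>2)"
      by simp
  qed
qed

lemma in_L2_cmult: "in_L2 f \<Longrightarrow> in_L2 (\<lambda>x. a * f x)"
  by (auto simp: in_L2_def norm_mult power_mult_distrib)

lemma convolve_translate_left:
  assumes [measurable]: "f \<in> borel_measurable lebesgue" "g \<in> borel_measurable lebesgue"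
  shows "convolve (translate c f) g = translate c (convolve f g)"
proof
  fix x
  have "(\<lambda>y. g (x - c - y)) \<in> borel_measurable lebesgue"
    by (rule measurable_lebesgue_reflect) fact
  then have "(\<integral>y. f (y - c) * g (x - c - (y - c)) \<partial>lebesgue) = (\<integral>y. f y * g (x - c - y) \<partial>lebesgue)"
    using assms(1) by (intro integral_lebesgue_shift[of "\<lambda>y. f y * g (x - c - y)"] borel_measurable_times)
  then show "convolve (translate c f) g x = translate c (convolve f g) x"
    by (simp add: convolve_def translate_def)
qed

text \<open>Moves the translation from the output to the filter. Both integrals converge at every
  point for L2 functions, so their difference is the integral of the difference.\<close>

lemma convolve_diff_translate:
  assumes h: "in_L2 h" and g: "in_L2 g"
  shows "convolve h g x - translate c (convolve h g) x = convolve h (\<lambda>y. g y - translate c g y) x"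
proof -
  have "integrable lebesgue (\<lambda>y. h y * translate c g (x - y))"
    by (intro integrable_convolve_integrand h in_L2_translate g)
  then have "integrable lebesgue (\<lambda>y. h y * g (x - c - y))"
    by (simp add: translate_def algebra_simps)
  then show ?thesis
    using integrable_convolve_integrand[OF h g, of x]
    by (simp add: convolve_def translate_def right_diff_distrib algebra_simps)
qed

lemma fourier_cmult: "fourier (\<lambda>x. a * f x) \<xi> = a * fourier f \<xi>"
  by (simp add: fourier_def mult.assoc)

lemma convolve_cmult: "convolve h (\<lambda>x. a * f x) x = a * convolve h f x"
  unfolding convolve_def by (subst integral_mult_right_zero[symmetric]) (simp only: mult_ac)

lemma fourier_diff_translate:
  assumes g: "in_L1 g"
  shows "fourier (\<lambda>x. g x - translate c g x) \<xi> = (1 - exp (- 2 * of_real pi * \<i> * of_real (c \<bullet> \<xi>))) * fourier g \<xi>"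
proof -
  let ?e = "\<lambda>x. exp (- 2 * complex_of_real pi * \<i> * of_real (x \<bullet> \<xi>))"
  have e: "?e \<in> borel_measurable lebesgue" by (rule measurable_completion) measurable
  have int: "integrable lebesgue (\<lambda>x. ?e x * f x)" if "integrable lebesgue f" for f
    by (rule integrable_bounded_mult[OF that e, of 1]) simp
  \<comment> \<open>The character property: splitting off \<open>?e c\<close> leaves an integrand
    that depends on \<open>x - c\<close> alone.\<close>
  have e_mult: "?e x * z = ?e c * (?e (x - c) * z)" for x z
    unfolding mult.assoc[symmetric] exp_add[symmetric] by (simp add: inner_diff_left algebra_simps)
  have g': "integrable lebesgue g" using g by (simp add: in_L1_def)
  have "fourier (\<lambda>x. g x - translate c g x) \<xi> = (\<integral>x. ?e x * g x - ?e x * g (x - c) \<partial>lebesgue)"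
    unfolding fourier_def translate_def by (simp only: mult.commute[of _ "?e _"] right_diff_distrib)
  also have "\<dots> = (\<integral>x. ?e x * g x \<partial>lebesgue) - (\<integral>x. ?e x * g (x - c) \<partial>lebesgue)"
    by (intro Bochner_Integration.integral_diff int integrable_lebesgue_shift g')
  also have "(\<integral>x. ?e x * g (x - c) \<partial>lebesgue) = (\<integral>x. ?e c * (?e (x - c) * g (x - c)) \<partial>lebesgue)"
    by (intro Bochner_Integration.integral_cong refl e_mult)
  also have "\<dots> = ?e c * (\<integral>x. ?e (x - c) * g (x - c) \<partial>lebesgue)"
    by simp
  also have "(\<integral>x. ?e (x - c) * g (x - c) \<partial>lebesgue) = (\<integral>x. ?e x * g x \<partial>lebesgue)"
    by (rule integral_lebesgue_shift[of "\<lambda>x. ?e x * g x"]) (rule borel_measurable_integrable[OF int[OF g']])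
  also have "(\<integral>x. ?e x * g x \<partial>lebesgue) = fourier g \<xi>"
    unfolding fourier_def by (simp only: mult.commute)
  finally show ?thesis by (simp add: left_diff_distrib)
qed

text \<open>The chord |1 - e^(i a)| is at most the arc |a|, which is \<open>iexp_approx1\<close> at
  order 0; Cauchy-Schwarz bounds the inner product.\<close>

lemma norm_one_minus_fourier_kernel_le:
  "cmod (1 - exp (- 2 * of_real pi * \<i> * of_real (c \<bullet> \<xi>))) \<le> 2 * pi * norm c * norm \<xi>"
proof -
  have "exp (- 2 * of_real pi * \<i> * of_real (c \<bullet> \<xi>)) = iexp (- 2 * pi * (c \<bullet> \<xi>))"
    by (rule arg_cong[where f = exp]) simp
  then have "cmod (1 - exp (- 2 * of_real pi * \<i> * of_real (c \<bullet> \<xi>))) \<le> \<bar>2 * pi * (c \<bullet> \<xi>)\<bar>"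
    using iexp_approx1[of "- 2 * pi * (c \<bullet> \<xi>)" 0] by (simp add: norm_minus_commute)
  also have "\<dots> \<le> 2 * pi * (norm c * norm \<xi>)"
    using Cauchy_Schwarz_ineq2[of c \<xi>] by (simp add: abs_mult)
  finally show ?thesis by (simp add: mult.assoc)
qed

text \<open>Reduces a bound on the sum over all paths to one that is uniform over finite sets of
  paths.\<close>

lemma infsum_ennreal_SUP:
  "infsum f A = (SUP F\<in>{F. finite F \<and> F \<subseteq> A}. sum f F)" for f :: "'b \<Rightarrow> ennreal"
  by (rule nonneg_infsum_complete) simp

lemma sum_le_infsum_ennreal:
  fixes f :: "'b \<Rightarrow> ennreal"
  assumes "finite F" "F \<subseteq> A"
  shows "sum f F \<le> infsum f A"
  unfolding infsum_ennreal_SUP using assms by (intro SUP_upper) simp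

lemma ennreal_sqrt_le:
  assumes "x \<le> y\<^sup>2"
  shows "ennreal_sqrt x \<le> y"
proof (cases y)
  case (real q)
  with assms have x: "x \<le> ennreal (q\<^sup>2)" by (simp add: ennreal_power)
  then have "x < \<top>" by (rule le_less_trans) simp
  with x obtain r where "x = ennreal r" "0 \<le> r" "r \<le> q\<^sup>2" by (cases x) auto
  then show ?thesis
    using real real_sqrt_le_mono[of r "q\<^sup>2"] by (simp add: ennreal_sqrt_def)
qed simp

subsection \<open>Energy of the scattering propagator\<close>

text \<open>The recursion at the first entry: the shorter path acts on a new signal, which suits
  inductions in which the signal is arbitrary.\<close>

lemma propagator_Cons:
  "propagator g (l # p) f = propagator g p (\<lambda>x. of_real (cmod (convolve f (g l) x)))"
  by (simp add: propagator_def)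

context
  fixes \<Lambda> :: "'i::zero set" and g :: "'i \<Rightarrow> 'a::euclidean_space \<Rightarrow> complex"
  assumes bessel: "semi_discrete_bessel \<Lambda> g"
begin

lemma bessel_L1: "i \<in> insert 0 \<Lambda> \<Longrightarrow> in_L1 (g i)"
  and bessel_L2: "i \<in> insert 0 \<Lambda> \<Longrightarrow> in_L2 (g i)"
  and zero_notin: "0 \<notin> \<Lambda>"
  using bessel by (auto simp: semi_discrete_bessel_def)

lemma bessel_sum_le:
  assumes "finite L" "L \<subseteq> insert 0 \<Lambda>"
  shows "AE \<xi> in lebesgue. (\<Sum>i\<in>L. ennreal ((cmod (fourier (g i) \<xi>))\<^sup>2)) \<le> 1"
proof -
  have "AE \<xi> in lebesgue. (\<Sum>\<^sub>\<infinity>i\<in>insert 0 \<Lambda>. ennreal ((cmod (fourier (g i) \<xi>))\<^sup>2)) \<le> 1"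
    using bessel by (simp add: semi_discrete_bessel_def)
  then show ?thesis
    by eventually_elim (rule order_trans[OF sum_le_infsum_ennreal[OF assms]])
qed

text \<open>The single filter \<open>g l\<close> is a Bessel family with bound 1, so the energy of
  the convolution is at most that of \<open>h\<close>.\<close>

lemma in_L2_propagator_step:
  assumes h: "in_L2 h" and l: "l \<in> \<Lambda>"
  shows "in_L2 (\<lambda>x. of_real (cmod (convolve h (g l) x)))"
proof -
  have "bessel_bound {l} g 1 h"
    using l bessel_L1 bessel_L2 by (intro bessel_bound_L2[OF h] bessel_sum_le) auto
  then have m: "convolve h (g l) \<in> borel_measurable lebesgue"
    and le: "(\<integral>\<^sup>+x. ennreal ((cmod (convolve h (g l) x))\<^sup>2) \<partial>lebesgue) \<le> (\<integral>\<^sup>+x. ennreal ((cmod (h x))\<^sup>2) \<partial>lebesgue)"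
    by (auto simp: bessel_bound_def)
  have "(\<integral>\<^sup>+x. ennreal ((cmod (h x))\<^sup>2) \<partial>lebesgue) < \<infinity>"
    using h by (subst nn_integral_eq_integral) (auto simp: in_L2_def)
  with le have "(\<integral>\<^sup>+x. ennreal ((cmod (convolve h (g l) x))\<^sup>2) \<partial>lebesgue) < \<infinity>"
    by (rule le_less_trans)
  with m show ?thesis
    unfolding in_L2_def by (auto simp: integrable_iff_bounded)
qed

lemma in_L2_propagator:
  "in_L2 h \<Longrightarrow> set p \<subseteq> \<Lambda> \<Longrightarrow> in_L2 (propagator g p h)"
  by (induction p arbitrary: h) (auto simp: propagator_Nil propagator_Cons in_L2_propagator_step)

text \<open>Convolution and the pointwise modulus both commute with translation; membership in L2 is
  carried along the path to supply measurability at each step.\<close>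

lemma propagator_translate:
  "in_L2 h \<Longrightarrow> set p \<subseteq> \<Lambda> \<Longrightarrow> propagator g p (translate c h) = translate c (propagator g p h)"
proof (induction p arbitrary: h)
  case (Cons l p)
  then have "convolve (translate c h) (g l) = translate c (convolve h (g l))"
    using bessel_L2[of l] by (intro convolve_translate_left) (auto simp: in_L2_def)
  then have "propagator g (l # p) (translate c h) = propagator g p (translate c (\<lambda>x. of_real (cmod (convolve h (g l) x))))"
    by (simp add: propagator_Cons translate_def[abs_def])
  also have "\<dots> = translate c (propagator g p (\<lambda>x. of_real (cmod (convolve h (g l) x))))"
    using Cons.prems by (intro Cons.IH in_L2_propagator_step) auto
  finally show ?case by (simp add: propagator_Cons)
qed (simp add: propagator_Nil)

lemma scattering_diff_translate:
  assumes h: "in_L2 h" and p: "set p \<subseteq> \<Lambda>"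
  shows "scattering g h p x - scattering g (translate c h) p x
    = convolve (propagator g p h) (\<lambda>y. g 0 y - translate c (g 0) y) x"
proof -
  have U: "in_L2 (propagator g p h)" by (rule in_L2_propagator[OF h p])
  have "scattering g (translate c h) p = translate c (convolve (propagator g p h) (g 0))"
    unfolding scattering_def propagator_translate[OF h p]
    using U bessel_L2[of 0] by (intro convolve_translate_left) (auto simp: in_L2_def)
  then show ?thesis
    using convolve_diff_translate[OF U bessel_L2[of 0]] by (simp add: scattering_def)
qed

text \<open>One layer of the energy balance. The term for \<open>k0\<close> is the output at the
  empty path; the terms for \<open>L\<close> are K^2 times the energies passed on to longer paths,
  which is what the induction in \<open>energy_paths\<close> consumes.\<close>

lemma energy_step:
  assumes h: "in_L2 h" and L: "finite L" "L \<subseteq> \<Lambda>"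
    and k0: "in_L1 k0" "in_L2 k0"
    and K: "K \<ge> 0" "\<And>\<xi>. cmod (fourier k0 \<xi>) \<le> K * cmod (fourier (g 0) \<xi>)"
  shows "(\<integral>\<^sup>+x. ennreal ((cmod (convolve h k0 x))\<^sup>2) \<partial>lebesgue)
      + (\<Sum>l\<in>L. ennreal (K\<^sup>2) * (\<integral>\<^sup>+x. ennreal ((cmod (convolve h (g l) x))\<^sup>2) \<partial>lebesgue))
    \<le> ennreal (K\<^sup>2) * (\<integral>\<^sup>+x. ennreal ((cmod (h x))\<^sup>2) \<partial>lebesgue)"
proof -
  \<comment> \<open>Every transform of \<open>k i\<close> is bounded by K times that of
    \<open>g i\<close>: by hypothesis at 0, with equality elsewhere. Hence the bound 1 for
    \<open>g\<close> becomes K^2.\<close>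
  define k where "k i = (if i = 0 then k0 else (\<lambda>x. of_real K * g i x))" for i
  \<comment> \<open>Keeps the slot of \<open>k0\<close> apart from the filters, so that the sum over
    \<open>insert 0 L\<close> splits.\<close>
  have 0: "0 \<notin> L" using L zero_notin by auto
  have k_L: "k l = (\<lambda>x. of_real K * g l x)" if "l \<in> L" for l
    using that 0 by (auto simp: k_def)
  have "bessel_bound (insert 0 L) k (ennreal (K\<^sup>2)) h"
  proof (rule bessel_bound_L2[OF h])
    have mem: "l \<in> insert 0 \<Lambda>" if "l \<in> L" for l using that L by auto
    show "in_L1 (k i)" if "i \<in> insert 0 L" for i
      using that k0 bessel_L1[OF mem] by (auto simp: k_def in_L1_def)
    show "in_L2 (k i)" if "i \<in> insert 0 L" for i
      using that k0 bessel_L2[OF mem] by (auto simp: k_def in_L2_cmult)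
    have le: "ennreal ((cmod (fourier (k i) \<xi>))\<^sup>2) \<le> ennreal (K\<^sup>2) * ennreal ((cmod (fourier (g i) \<xi>))\<^sup>2)" for i \<xi>
    proof -
      have "cmod (fourier (k i) \<xi>) \<le> K * cmod (fourier (g i) \<xi>)"
        using K by (auto simp: k_def fourier_cmult norm_mult)
      then have "(cmod (fourier (k i) \<xi>))\<^sup>2 \<le> (K * cmod (fourier (g i) \<xi>))\<^sup>2"
        by (rule power_mono) simp
      then show ?thesis
        by (simp add: power_mult_distrib ennreal_mult[symmetric])
    qed
    have "AE \<xi> in lebesgue. (\<Sum>i\<in>insert 0 L. ennreal ((cmod (fourier (g i) \<xi>))\<^sup>2)) \<le> 1"
      using L by (intro bessel_sum_le) auto
    then show "AE \<xi> in lebesgue. (\<Sum>i\<in>insert 0 L. ennreal ((cmod (fourier (k i) \<xi>))\<^sup>2)) \<le> ennreal (K\<^sup>2)"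
    proof eventually_elim
      case (elim \<xi>)
      have "(\<Sum>i\<in>insert 0 L. ennreal ((cmod (fourier (k i) \<xi>))\<^sup>2))
          \<le> ennreal (K\<^sup>2) * (\<Sum>i\<in>insert 0 L. ennreal ((cmod (fourier (g i) \<xi>))\<^sup>2))"
        unfolding sum_distrib_left by (rule sum_mono[OF le])
      also have "\<dots> \<le> ennreal (K\<^sup>2) * 1"
        by (rule mult_left_mono[OF elim]) simp
      finally show ?case by simp
    qed
  qed simp
  then have m: "\<And>i. i \<in> insert 0 L \<Longrightarrow> convolve h (k i) \<in> borel_measurable lebesgue"
    and le: "(\<integral>\<^sup>+x. (\<Sum>i\<in>insert 0 L. ennreal ((cmod (convolve h (k i) x))\<^sup>2)) \<partial>lebesgue)
      \<le> ennreal (K\<^sup>2) * (\<integral>\<^sup>+x. ennreal ((cmod (h x))\<^sup>2) \<partial>lebesgue)"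
    by (auto simp: bessel_bound_def)
  have "convolve h (g l) \<in> borel_measurable lebesgue" if "l \<in> L" for l
  proof -
    have "bessel_bound {l} g 1 h"
      using that L bessel_L1 bessel_L2 by (intro bessel_bound_L2[OF h] bessel_sum_le) auto
    then show ?thesis by (simp add: bessel_bound_def)
  qed
  then have "(\<integral>\<^sup>+x. ennreal ((cmod (convolve h (k l) x))\<^sup>2) \<partial>lebesgue)
     = ennreal (K\<^sup>2) * (\<integral>\<^sup>+x. ennreal ((cmod (convolve h (g l) x))\<^sup>2) \<partial>lebesgue)" if "l \<in> L" for l
    using that by (subst nn_integral_cmult[symmetric])
      (auto simp: k_L convolve_cmult norm_mult power_mult_distrib ennreal_mult)
  then have "(\<Sum>i\<in>insert 0 L. \<integral>\<^sup>+x. ennreal ((cmod (convolve h (k i) x))\<^sup>2) \<partial>lebesgue)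
     = (\<integral>\<^sup>+x. ennreal ((cmod (convolve h k0 x))\<^sup>2) \<partial>lebesgue)
      + (\<Sum>l\<in>L. ennreal (K\<^sup>2) * (\<integral>\<^sup>+x. ennreal ((cmod (convolve h (g l) x))\<^sup>2) \<partial>lebesgue))"
    using L 0 by (simp add: k_def[of 0])
  moreover have "(\<integral>\<^sup>+x. (\<Sum>i\<in>insert 0 L. ennreal ((cmod (convolve h (k i) x))\<^sup>2)) \<partial>lebesgue)
    = (\<Sum>i\<in>insert 0 L. \<integral>\<^sup>+x. ennreal ((cmod (convolve h (k i) x))\<^sup>2) \<partial>lebesgue)"
    using m by (intro nn_integral_sum) measurable
  ultimately show ?thesis using le by simp
qed

text \<open>Induction on a bound for the path lengths, with the signal arbitrary. Grouping the paths
  by first entry leaves shorter paths for a propagated signal. The induction hypothesis bounds the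
  outputs of each group by K^2 times the energy of that signal, and \<open>energy_step\<close>
  absorbs these energies together with the output of the empty path.\<close>

lemma energy_paths:
  assumes k0: "in_L1 k0" "in_L2 k0"
    and K: "K \<ge> 0" "\<And>\<xi>. cmod (fourier k0 \<xi>) \<le> K * cmod (fourier (g 0) \<xi>)"
    and F: "finite F" "\<And>p. p \<in> F \<Longrightarrow> set p \<subseteq> \<Lambda> \<and> length p < n" and h: "in_L2 h"
  shows "(\<Sum>p\<in>F. \<integral>\<^sup>+x. ennreal ((cmod (convolve (propagator g p h) k0 x))\<^sup>2) \<partial>lebesgue)
    \<le> ennreal (K\<^sup>2) * (\<integral>\<^sup>+x. ennreal ((cmod (h x))\<^sup>2) \<partial>lebesgue)"
  using F h
proof (induction n arbitrary: F h)
  case 0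
  then have "F = {}" by auto
  then show ?case by simp
next
  case (Suc n)
  let ?b = "\<lambda>p h. \<integral>\<^sup>+x. ennreal ((cmod (convolve (propagator g p h) k0 x))\<^sup>2) \<partial>lebesgue"
  let ?step = "\<lambda>l h x. complex_of_real (cmod (convolve h (g l) x))"
  define T where "T l = {q. l # q \<in> F}" for l
  define L where "L = {l. T l \<noteq> {}}"
  have fin_T: "finite (T l)" for l
  proof -
    have "T l = (\<lambda>q. l # q) -` F" by (auto simp: T_def)
    then show ?thesis using finite_vimageI[OF Suc.prems(1), of "\<lambda>q. l # q"] by (simp add: inj_def)
  qed
  have "L \<subseteq> hd ` F" by (force simp: L_def T_def)
  then have fin_L: "finite L" using Suc.prems(1) finite_surj by blast
  have L: "L \<subseteq> \<Lambda>" using Suc.prems(2) by (fastforce simp: L_def T_def)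
  \<comment> \<open>An inclusion suffices because the terms are nonnegative; the empty path is added
    whether or not it belongs to \<open>F\<close>.\<close>
  have sub: "F \<subseteq> insert [] ((\<lambda>(l, q). l # q) ` Sigma L T)"
  proof
    fix p assume "p \<in> F"
    then show "p \<in> insert [] ((\<lambda>(l, q). l # q) ` Sigma L T)"
      by (cases p) (auto simp: L_def T_def image_iff)
  qed
  have "(\<Sum>p\<in>F. ?b p h) \<le> (\<Sum>p\<in>insert [] ((\<lambda>(l, q). l # q) ` Sigma L T). ?b p h)"
    using fin_L fin_T by (intro sum_mono2 sub) auto
  also have "\<dots> = ?b [] h + (\<Sum>p\<in>(\<lambda>(l, q). l # q) ` Sigma L T. ?b p h)"
    using fin_L fin_T by (intro sum.insert) auto
  also have "(\<Sum>p\<in>(\<lambda>(l, q). l # q) ` Sigma L T. ?b p h) = (\<Sum>(l, q)\<in>Sigma L T. ?b (l # q) h)"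
    by (subst sum.reindex) (auto simp: inj_on_def case_prod_beta)
  also have "\<dots> = (\<Sum>l\<in>L. \<Sum>q\<in>T l. ?b q (?step l h))"
    using fin_L fin_T by (subst sum.Sigma) (auto simp: propagator_Cons)
  also have "\<dots> \<le> (\<Sum>l\<in>L. ennreal (K\<^sup>2) * (\<integral>\<^sup>+x. ennreal ((cmod (?step l h x))\<^sup>2) \<partial>lebesgue))"
  proof (rule sum_mono, rule Suc.IH[OF fin_T])
    fix l assume l: "l \<in> L"
    show "set q \<subseteq> \<Lambda> \<and> length q < n" if "q \<in> T l" for q
      using Suc.prems(2)[of "l # q"] that by (simp add: T_def)
    show "in_L2 (?step l h)"
      using l L by (intro in_L2_propagator_step Suc.prems(3)) auto
  qed
  also have "?b [] h + (\<Sum>l\<in>L. ennreal (K\<^sup>2) * (\<integral>\<^sup>+x. ennreal ((cmod (?step l h x))\<^sup>2) \<partial>lebesgue))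
    \<le> ennreal (K\<^sup>2) * (\<integral>\<^sup>+x. ennreal ((cmod (h x))\<^sup>2) \<partial>lebesgue)"
    using energy_step[OF Suc.prems(3) fin_L L k0 K] by (simp add: propagator_Nil)
  finally show ?case by (simp add: add_left_mono)
qed

end

section \<open>The translation bound\<close>

theorem theorem3p1:
  fixes \<Lambda> :: "'i::zero set"
    and g :: "'i \<Rightarrow> real ^ 'd \<Rightarrow> complex"
    and f :: "real ^ 'd \<Rightarrow> complex"
    and c :: "real ^ 'd"
    and P :: "'i list set"
    and D :: ennreal
  assumes bessel: "semi_discrete_bessel \<Lambda> g"
    and P: "P = (\<Union>n. {p. length p = n \<and> set p \<subseteq> \<Lambda>})"
    and D: "D = (SUP \<xi>\<in>{\<xi>. fourier (g 0) \<xi> \<noteq> 0}. ennreal (norm \<xi>))"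
    and D_finite: "D < \<infinity>"
    and f: "in_L2 f"
  shows "L2l2_norm P (\<lambda>p x. scattering g f p x - scattering g (translate c f) p x)
           \<le> ennreal (2 * pi) * D * ennreal (norm c) * L2_norm f"
proof -
  \<comment> \<open>If \<open>fourier (g 0)\<close> vanishes everywhere, the supremum in
    \<open>D\<close> is over the empty set and equals 0 in [0, \<infinity>]; then \<open>K\<close>
    is 0 and \<open>bound\<close> reads 0 \<le> 0.\<close>
  define d where "d = enn2real D"
  have d: "D = ennreal d" "d \<ge> 0" using D_finite by (auto simp: d_def)
  define K where "K = 2 * pi * d * norm c"
  have K: "K \<ge> 0" using d by (simp add: K_def)
  define k0 where "k0 x = g 0 x - translate c (g 0) x" for x
  have g0: "in_L1 (g 0)" "in_L2 (g 0)"
    using bessel_L1[OF bessel] bessel_L2[OF bessel] by auto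
  have k0: "in_L1 k0" "in_L2 k0"
    using g0 in_L1_translate[OF g0(1), of c] in_L2_diff[OF g0(2) in_L2_translate[OF g0(2), of c]]
    unfolding k0_def by (auto simp: in_L1_def)
  have fourier_k0: "fourier k0 \<xi> = (1 - exp (- 2 * of_real pi * \<i> * of_real (c \<bullet> \<xi>))) * fourier (g 0) \<xi>" for \<xi>
    unfolding k0_def[abs_def] by (rule fourier_diff_translate[OF g0(1)])
  \<comment> \<open>Where \<open>fourier (g 0)\<close> vanishes both sides are 0; elsewhere |\<xi>|
    \<le> d turns the chord estimate into the factor \<open>K\<close>.\<close>
  have bound: "cmod (fourier k0 \<xi>) \<le> K * cmod (fourier (g 0) \<xi>)" for \<xi>
  proof (cases "fourier (g 0) \<xi> = 0")
    case False
    then have "ennreal (norm \<xi>) \<le> D" unfolding D by (intro SUP_upper) simp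
    then have "norm \<xi> \<le> d" using d by simp
    then have "2 * pi * norm c * norm \<xi> \<le> K"
      unfolding K_def by (simp add: mult.assoc mult.commute[of d] mult_left_mono)
    with norm_one_minus_fourier_kernel_le[of c \<xi>]
    have "cmod (1 - exp (- 2 * of_real pi * \<i> * of_real (c \<bullet> \<xi>))) \<le> K" by linarith
    then show ?thesis
      unfolding fourier_k0 norm_mult by (rule mult_right_mono) simp
  qed (simp add: fourier_k0)
  let ?h = "\<lambda>p x. scattering g f p x - scattering g (translate c f) p x"
  let ?E = "\<integral>\<^sup>+x. ennreal ((cmod (f x))\<^sup>2) \<partial>lebesgue"
  have P_set: "set p \<subseteq> \<Lambda>" if "p \<in> P" for p using that by (auto simp: P)
  have "(\<Sum>\<^sub>\<infinity>p\<in>P. (L2_norm (?h p))\<^sup>2) \<le> ennreal (K\<^sup>2) * ?E"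
    unfolding infsum_ennreal_SUP
  proof (rule SUP_least, clarify)
    fix F assume F: "finite F" "F \<subseteq> P"
    have "(\<Sum>p\<in>F. (L2_norm (?h p))\<^sup>2) = (\<Sum>p\<in>F. \<integral>\<^sup>+x. ennreal ((cmod (convolve (propagator g p f) k0 x))\<^sup>2) \<partial>lebesgue)"
      using P_set F unfolding k0_def
      by (intro sum.cong) (auto simp: L2_norm_def ennreal_sqrt_power2 scattering_diff_translate[OF bessel f])
    also have "\<dots> \<le> ennreal (K\<^sup>2) * ?E"
    proof (rule energy_paths[OF bessel k0 K bound F(1) _ f])
      \<comment> \<open>\<open>Suc\<close> of the largest length provides the strict bound asked for
        by \<open>energy_paths\<close>.\<close>
      show "set p \<subseteq> \<Lambda> \<and> length p < Suc (Max (length ` F))" if "p \<in> F" for p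
        using that F P_set by (auto simp: less_Suc_eq_le)
    qed
    finally show "(\<Sum>p\<in>F. (L2_norm (?h p))\<^sup>2) \<le> ennreal (K\<^sup>2) * ?E" .
  qed
  also have "\<dots> = (ennreal (2 * pi) * D * ennreal (norm c) * L2_norm f)\<^sup>2"
    using d K by (simp add: L2_norm_def power_mult_distrib ennreal_sqrt_power2 K_def ennreal_mult ennreal_power)
  finally show ?thesis
    unfolding L2l2_norm_def by (rule ennreal_sqrt_le)
qed

end
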